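(* Let $G=(V,E)$ be a finite directed graph in which every vertex has at least one incoming edge and at least one outgoing edge, and suppose that $G$ does not have multi-edges. Then $h_{top}(D_G^V)=h_{top}(D_G^E)$.
   Context: Markov-Dyck shift of a matrix. Let $A=[A(i,j)]_{i,j=1}^{M}$ be a $\{0,1\}$-matrix with no zero row and no zero column. Let $\mathcal O_A$ be the Cuntz-Krieger algebra, i.e. the universal $C^*$-algebra generated by partial isometries $t_1,\dots,t_M$ subject to $\sum_{j=1}^M t_jt_j^*=1$ and $t_i^*t_i=\sum_{j=1}^M A(i,j)t_jt_j^*$ for $i=1,\dots,M$. Let $\Sigma=\{\alpha_1,\dots,\alpha_M\}\cup\{\beta_1,\dots,\beta_M\}$ (disjoint), and $\varphi_A(\alpha_i)=t_i^*$, $\varphi_A(\beta_i)=t_i$. A word $\gamma_1\cdots\gamma_n$ over $\Sigma$ is forbidden if $\varphi_A(\gamma_1)\cdots\varphi_A(\gamma_n)=0$ in $\mathcal O_A$. The Markov-Dyck shift $D_A\subset\Sigma^{\mathbb Z}$ is the subshift of all bi-infinite sequences containing no forbidden word. Graphs. For a finite directed graph $G=(V,E)$ with $V=\{v_1,\dots,v_{N_0}\}$, $E=\{e_1,\dots,e_{N_1}\}$, where $s(e)$ and $t(e)$ denote the initial and final vertex of $e$, the edge matrix $A^G$ is the $N_1\times N_1$ matrix with $A^G(i,j)=1$ if $t(e_i)=s(e_j)$ and $0$ otherwise; the vertex matrix $A_G$ is the $N_0\times N_0$ matrix with $A_G(i,j)=1$ if there is an edge from $v_i$ to $v_j$ and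 $0$ otherwise. $D_G^E:=D_{A^G}$ (Markov-Dyck shift of edge type) and $D_G^V:=D_{A_G}$ (of vertex type). Entropy. For a subshift $\Lambda$, $B_n(\Lambda)$ is the set of words of length $n$ appearing in elements of $\Lambda$, and $h_{top}(\Lambda)=\lim_{n\to\infty}\frac1n\log|B_n(\Lambda)|$. *)

theory Defs
  imports Complex_Main "HOL-Library.Poly_Mapping" "HOL-Algebra.Module" "Graph_Theory.Digraph"
begin
text \<open>
  Every separable complex Hilbert space is unitarily equivalent to
  \<open>l2 X = {f. f is square summable and supported in X}\<close> for some set \<open>X\<close> of natural
  numbers.  Separable spaces suffice for the representations of a countably generated algebra:
  every vector lies in a separable subspace that is invariant under the generators and their
  adjoints.  The choice \<open>X = {}\<close> gives the zero space.
  Operators are total functions of which only the values on \<open>l2 X\<close> are used.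
\<close>

definition l2 :: "nat set \<Rightarrow> (nat \<Rightarrow> complex) set" where
  "l2 X = {f. (\<forall>n. n \<notin> X \<longrightarrow> f n = 0) \<and> summable (\<lambda>n. (cmod (f n))\<^sup>2)}"

definition l2_inner :: "(nat \<Rightarrow> complex) \<Rightarrow> (nat \<Rightarrow> complex) \<Rightarrow> complex" where
  "l2_inner f g = suminf (\<lambda>n. f n * cnj (g n))"

definition l2_norm :: "(nat \<Rightarrow> complex) \<Rightarrow> real" where
  "l2_norm f = sqrt (suminf (\<lambda>n. (cmod (f n))\<^sup>2))"

type_synonym l2_op = "(nat \<Rightarrow> complex) \<Rightarrow> (nat \<Rightarrow> complex)"

definition bounded_op :: "nat set \<Rightarrow> l2_op \<Rightarrow> bool" where
  "bounded_op X T \<longleftrightarrow>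
     (\<forall>f \<in> l2 X. T f \<in> l2 X) \<and>
     (\<forall>f \<in> l2 X. \<forall>g \<in> l2 X. T (\<lambda>n. f n + g n) = (\<lambda>n. T f n + T g n)) \<and>
     (\<forall>c. \<forall>f \<in> l2 X. T (\<lambda>n. c * f n) = (\<lambda>n. c * T f n)) \<and>
     (\<exists>K. \<forall>f \<in> l2 X. l2_norm (T f) \<le> K * l2_norm f)"

definition op_norm :: "nat set \<Rightarrow> l2_op \<Rightarrow> real" where
  "op_norm X T = Sup {l2_norm (T f) | f. f \<in> l2 X \<and> l2_norm f \<le> 1}"

definition is_adjoint :: "nat set \<Rightarrow> l2_op \<Rightarrow> l2_op \<Rightarrow> bool" where
  "is_adjoint X T S \<longleftrightarrow> (\<forall>f \<in> l2 X. \<forall>g \<in> l2 X. l2_inner (T f) g = l2_inner f (S g))"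

datatype 'i gen = Gen 'i | Gen_star 'i

primrec gen_star :: "'i gen \<Rightarrow> 'i gen" where
  "gen_star (Gen i) = Gen_star i"
| "gen_star (Gen_star i) = Gen i"

text \<open>
  Noncommutative *-polynomials: finitely supported complex combinations of words in the
  generators and their formal adjoints.  Addition is that of the type \<open>poly_mapping\<close>; its
  multiplication is not available since lists are not in the class \<open>monoid_add\<close>.
\<close>

type_synonym 'i ncpoly = "'i gen list \<Rightarrow>\<^sub>0 complex"

definition free_carrier :: "'i set \<Rightarrow> 'i ncpoly set" where
  "free_carrier I = {p. \<forall>w \<in> Poly_Mapping.keys p. set w \<subseteq> Gen ` I \<union> Gen_star ` I}"

definition free_gen :: "'i \<Rightarrow> 'i ncpoly" where
  "free_gen i = Poly_Mapping.single [Gen i] 1"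

definition free_one :: "'i ncpoly" where
  "free_one = Poly_Mapping.single [] 1"

definition free_mult :: "'i ncpoly \<Rightarrow> 'i ncpoly \<Rightarrow> 'i ncpoly" where
  "free_mult p q =
     (\<Sum>u \<in> Poly_Mapping.keys p. \<Sum>v \<in> Poly_Mapping.keys q.
        Poly_Mapping.single (u @ v) (Poly_Mapping.lookup p u * Poly_Mapping.lookup q v))"

definition free_smult :: "complex \<Rightarrow> 'i ncpoly \<Rightarrow> 'i ncpoly" where
  "free_smult c p = Poly_Mapping.map ((*) c) p"

definition free_star :: "'i ncpoly \<Rightarrow> 'i ncpoly" where
  "free_star p =
     (\<Sum>w \<in> Poly_Mapping.keys p.
        Poly_Mapping.single (rev (map gen_star w)) (cnj (Poly_Mapping.lookup p w)))"

text \<open>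
  \<open>S i\<close> is the adjoint of \<open>T i\<close>, and \<open>T i (S i (T i f)) = T i f\<close> expresses that \<open>T i\<close> is a partial
  isometry.  The matrix \<open>A\<close> is indexed by the finite set \<open>I\<close>.
\<close>

definition ck_family ::
    "'i set \<Rightarrow> ('i \<Rightarrow> 'i \<Rightarrow> nat) \<Rightarrow> nat set \<Rightarrow> ('i \<Rightarrow> l2_op) \<Rightarrow> ('i \<Rightarrow> l2_op) \<Rightarrow> bool" where
  "ck_family I A X T S \<longleftrightarrow>
     (\<forall>i \<in> I. bounded_op X (T i) \<and> bounded_op X (S i) \<and> is_adjoint X (T i) (S i)) \<and>
     (\<forall>i \<in> I. \<forall>f \<in> l2 X. T i (S i (T i f)) = T i f) \<and>
     (\<forall>f \<in> l2 X. (\<lambda>n. \<Sum>j\<in>I. T j (S j f) n) = f) \<and>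
     (\<forall>i \<in> I. \<forall>f \<in> l2 X. S i (T i f) = (\<lambda>n. \<Sum>j\<in>I. of_nat (A i j) * T j (S j f) n))"

primrec gen_op :: "('i \<Rightarrow> l2_op) \<Rightarrow> ('i \<Rightarrow> l2_op) \<Rightarrow> 'i gen \<Rightarrow> l2_op" where
  "gen_op T S (Gen i) = T i"
| "gen_op T S (Gen_star i) = S i"

definition free_rep :: "('i \<Rightarrow> l2_op) \<Rightarrow> ('i \<Rightarrow> l2_op) \<Rightarrow> 'i ncpoly \<Rightarrow> l2_op" where
  "free_rep T S p = (\<lambda>f n. \<Sum>w \<in> Poly_Mapping.keys p.
      Poly_Mapping.lookup p w * foldr (gen_op T S) w f n)"

text \<open>
  The supremum is finite on \<open>free_carrier I\<close> because partial isometries are contractions, and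
  the set is nonempty because there is always the representation on the zero space.
\<close>

definition univ_seminorm :: "'i set \<Rightarrow> ('i \<Rightarrow> 'i \<Rightarrow> nat) \<Rightarrow> 'i ncpoly \<Rightarrow> real" where
  "univ_seminorm I A p = Sup {op_norm X (free_rep T S p) | X T S. ck_family I A X T S}"

text \<open>
  The universal C*-algebra on generators and relations: divide the free *-algebra by the
  null space of the universal seminorm and complete.  Its elements are the classes of Cauchy
  sequences in the free *-algebra modulo sequences tending to 0 in the universal seminorm.
\<close>

record 'c cstar_alg = "(complex, 'c) module" +
  cstar :: "'c \<Rightarrow> 'c"
  cnorm :: "'c \<Rightarrow> real"

definition ck_Cauchy :: "'i set \<Rightarrow> ('i \<Rightarrow> 'i \<Rightarrow> nat) \<Rightarrow> (nat \<Rightarrow> 'i ncpoly) \<Rightarrow> bool" where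
  "ck_Cauchy I A x \<longleftrightarrow> (\<forall>n. x n \<in> free_carrier I) \<and>
     (\<forall>e>0. \<exists>N. \<forall>m\<ge>N. \<forall>n\<ge>N. univ_seminorm I A (x m - x n) < e)"

definition ck_class ::
    "'i set \<Rightarrow> ('i \<Rightarrow> 'i \<Rightarrow> nat) \<Rightarrow> (nat \<Rightarrow> 'i ncpoly) \<Rightarrow> (nat \<Rightarrow> 'i ncpoly) set" where
  "ck_class I A x =
     {y. ck_Cauchy I A y \<and> (\<lambda>n. univ_seminorm I A (x n - y n)) \<longlonglongrightarrow> 0}"

definition cuntz_krieger ::
    "'i set \<Rightarrow> ('i \<Rightarrow> 'i \<Rightarrow> nat) \<Rightarrow> (nat \<Rightarrow> 'i ncpoly) set cstar_alg" where
  "cuntz_krieger I A =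
    \<lparr> carrier = {ck_class I A x | x. ck_Cauchy I A x},
      mult = (\<lambda>a b. \<Union>x\<in>a. \<Union>y\<in>b. ck_class I A (\<lambda>n. free_mult (x n) (y n))),
      one = ck_class I A (\<lambda>_. free_one),
      zero = ck_class I A (\<lambda>_. 0),
      add = (\<lambda>a b. \<Union>x\<in>a. \<Union>y\<in>b. ck_class I A (\<lambda>n. x n + y n)),
      smult = (\<lambda>c a. \<Union>x\<in>a. ck_class I A (\<lambda>n. free_smult c (x n))),
      cstar = (\<lambda>a. \<Union>x\<in>a. ck_class I A (\<lambda>n. free_star (x n))),
      cnorm = (\<lambda>a. THE r. \<forall>x\<in>a. (\<lambda>n. univ_seminorm I A (x n)) \<longlonglongrightarrow> r) \<rparr>"

definition ck_gen :: "'i set \<Rightarrow> ('i \<Rightarrow> 'i \<Rightarrow> nat) \<Rightarrow> 'i \<Rightarrow> (nat \<Rightarrow> 'i ncpoly) set" where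
  "ck_gen I A i = ck_class I A (\<lambda>_. free_gen i)"

datatype 'i letter = Alpha 'i | Beta 'i

primrec ck_phi :: "'i set \<Rightarrow> ('i \<Rightarrow> 'i \<Rightarrow> nat) \<Rightarrow> 'i letter \<Rightarrow> (nat \<Rightarrow> 'i ncpoly) set" where
  "ck_phi I A (Alpha i) = cstar (cuntz_krieger I A) (ck_gen I A i)"
| "ck_phi I A (Beta i) = ck_gen I A i"

definition forbidden :: "'i set \<Rightarrow> ('i \<Rightarrow> 'i \<Rightarrow> nat) \<Rightarrow> 'i letter list \<Rightarrow> bool" where
  "forbidden I A w \<longleftrightarrow>
     foldr (\<lambda>g a. ck_phi I A g \<otimes>\<^bsub>cuntz_krieger I A\<^esub> a) w \<one>\<^bsub>cuntz_krieger I A\<^esub>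
       = \<zero>\<^bsub>cuntz_krieger I A\<^esub>"

definition subword :: "(int \<Rightarrow> 'a) \<Rightarrow> int \<Rightarrow> nat \<Rightarrow> 'a list" where
  "subword x k n = map (\<lambda>j. x (k + int j)) [0..<n]"

definition markov_dyck :: "'i set \<Rightarrow> ('i \<Rightarrow> 'i \<Rightarrow> nat) \<Rightarrow> (int \<Rightarrow> 'i letter) set" where
  "markov_dyck I A =
     {x. (\<forall>k. x k \<in> Alpha ` I \<union> Beta ` I) \<and> (\<forall>k n. \<not> forbidden I A (subword x k n))}"

definition blocks :: "nat \<Rightarrow> (int \<Rightarrow> 'a) set \<Rightarrow> 'a list set" where
  "blocks n \<Lambda> = {subword x k n | x k. x \<in> \<Lambda>}"

definition h_top :: "(int \<Rightarrow> 'a) set \<Rightarrow> real" where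
  "h_top \<Lambda> = lim (\<lambda>n. ln (real (card (blocks n \<Lambda>))) / real n)"

definition edge_matrix :: "('v, 'e) pre_digraph \<Rightarrow> 'e \<Rightarrow> 'e \<Rightarrow> nat" where
  "edge_matrix G e f = (if head G e = tail G f then 1 else 0)"

definition vertex_matrix :: "('v, 'e) pre_digraph \<Rightarrow> 'v \<Rightarrow> 'v \<Rightarrow> nat" where
  "vertex_matrix G u v = (if \<exists>e \<in> arcs G. tail G e = u \<and> head G e = v then 1 else 0)"

definition markov_dyck_edge :: "('v, 'e) pre_digraph \<Rightarrow> (int \<Rightarrow> 'e letter) set" where
  "markov_dyck_edge G = markov_dyck (arcs G) (edge_matrix G)"

definition markov_dyck_vertex :: "('v, 'e) pre_digraph \<Rightarrow> (int \<Rightarrow> 'v letter) set" where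
  "markov_dyck_vertex G = markov_dyck (verts G) (vertex_matrix G)"

end

theory Submission
  imports Defs "HOL-Analysis.L2_Norm" "HOL-Analysis.Infinite_Sum" "HOL-Library.Countable_Set"
begin

text \<open>
  A word over the letters \<open>Alpha i\<close>, \<open>Beta i\<close> is read as a partial map on infinite paths of the matrix:
  going through the word from right to left, \<open>Beta i\<close> puts \<open>i\<close> in front of the path, if that is a
  path again, and \<open>Alpha i\<close> removes a leading \<open>i\<close>.  A word is not forbidden if and only if this partial
  map is defined somewhere (\<open>not_forbidden_iff_path_run\<close>).  If it is defined at a path \<open>x\<close>, then the
  word acts nontrivially in the Cuntz-Krieger family that lives on the square summable functions on the
  countable set of paths with the same tail as \<open>x\<close>.  Conversely, let a word be nonzero in some
  Cuntz-Krieger family.  As \<open>1\<close> is the sum of the \<open>T j S j\<close>, there is a sequence \<open>x\<close> such that the word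
  is nonzero on the range of \<open>T (x 0) \<dots> T (x (m - 1))\<close> for all \<open>m\<close>; the relations force \<open>x\<close> to be a
  path, and they move \<open>T (x 0) \<dots> T (x (m - 1))\<close> through the word letter by letter, exactly as the
  partial map moves \<open>x\<close>.  The passage from the algebra, a completion of a quotient of noncommutative
  polynomials, to its families of operators only uses that the universal seminorm is submultiplicative
  and invariant under the adjoint.

  A word that is not forbidden is continued to the right by the letters \<open>Beta (x 0)\<close>, \<open>Beta (x 1)\<close>,
  \<open>\<dots>\<close>, which build up the path \<open>x\<close> on which it acts, and to the left by putting predecessors in front
  of the result.  So the blocks of a Markov-Dyck shift are all the words that are not forbidden
  (\<open>blocks_markov_dyck\<close>).

  Without multiple edges, an edge path is the same thing as a vertex path, and replacing edges by their
  tails maps the words over the edges onto the words over the vertices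
  (\<open>allowed_vertex_words_eq\<close>).  This map is at most \<open>|V|\<close> to one (\<open>card_allowed_edge_words_le\<close>): an edge
  is determined by its tail and its head, the tail is recorded in the vertex word, and the head is the
  next vertex of the current path.  That vertex is recorded in the vertex word as well, by the letter
  that has put it there or by the letter that will remove it, unless it is the first vertex of the
  starting path that the word leaves in place; that one vertex is free.  Hence the numbers of blocks
  differ at most by the factor \<open>|V|\<close>, which does not change the exponential growth rate.
\<close>

section \<open>The Hilbert spaces\<close>

lemma l2_summable: "f \<in> l2 X \<Longrightarrow> summable (\<lambda>n. (cmod (f n))\<^sup>2)"
  by (simp add: l2_def)

lemma l2_zero [simp]: "(\<lambda>n. 0) \<in> l2 X"
  by (simp add: l2_def)

lemma l2_summable_prod:
  assumes "f \<in> l2 X" "g \<in> l2 X"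
  shows "summable (\<lambda>n. cmod (f n * cnj (g n)))"
proof (rule summable_comparison_test')
  show "summable (\<lambda>n. (cmod (f n))\<^sup>2 + (cmod (g n))\<^sup>2)"
    using assms by (intro summable_add l2_summable)
  show "norm (cmod (f n * cnj (g n))) \<le> (cmod (f n))\<^sup>2 + (cmod (g n))\<^sup>2" for n
  proof -
    have "2 * (cmod (f n) * cmod (g n)) \<le> (cmod (f n))\<^sup>2 + (cmod (g n))\<^sup>2"
      using sum_squares_bound[of "cmod (f n)" "cmod (g n)"] by simp
    moreover have "0 \<le> cmod (f n) * cmod (g n)" by simp
    ultimately show ?thesis by (simp only: norm_mult complex_mod_cnj real_norm_def abs_mult abs_norm_cancel)
  qed
qed

lemma l2_summable_inner: "f \<in> l2 X \<Longrightarrow> g \<in> l2 X \<Longrightarrow> summable (\<lambda>n. f n * cnj (g n))"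
  by (rule summable_norm_cancel) (rule l2_summable_prod)

lemma l2_scale [simp]: "f \<in> l2 X \<Longrightarrow> (\<lambda>n. c * f n) \<in> l2 X"
  by (auto simp: l2_def norm_mult power_mult_distrib intro: summable_mult)

lemma l2_uminus [simp]: "f \<in> l2 X \<Longrightarrow> (\<lambda>n. - f n) \<in> l2 X"
  by (simp add: l2_def)

lemma l2_add [simp]:
  assumes "f \<in> l2 X" "g \<in> l2 X"
  shows "(\<lambda>n. f n + g n) \<in> l2 X"
proof -
  have "summable (\<lambda>n. (cmod (f n + g n))\<^sup>2)"
  proof (rule summable_comparison_test')
    show "summable (\<lambda>n. 2 * (cmod (f n))\<^sup>2 + 2 * (cmod (g n))\<^sup>2)"
      using assms by (intro summable_add summable_mult l2_summable)
    fix n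
    have "(cmod (f n + g n))\<^sup>2 \<le> (cmod (f n) + cmod (g n))\<^sup>2"
      by (intro power_mono norm_triangle_ineq) simp
    also have "\<dots> \<le> 2 * (cmod (f n))\<^sup>2 + 2 * (cmod (g n))\<^sup>2"
      using sum_squares_bound[of "cmod (f n)" "cmod (g n)"]
      by (simp add: power2_sum)
    finally show "norm ((cmod (f n + g n))\<^sup>2) \<le> 2 * (cmod (f n))\<^sup>2 + 2 * (cmod (g n))\<^sup>2"
      by simp
  qed
  with assms show ?thesis by (simp add: l2_def)
qed

lemma l2_sum [simp]: "(\<And>k. k \<in> K \<Longrightarrow> h k \<in> l2 X) \<Longrightarrow> (\<lambda>n. \<Sum>k\<in>K. h k n) \<in> l2 X"
  by (induction K rule: infinite_finite_induct) simp_all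

lemma l2_inner_add_left:
  "\<lbrakk>f \<in> l2 X; g \<in> l2 X; h \<in> l2 X\<rbrakk> \<Longrightarrow> l2_inner (\<lambda>n. f n + g n) h = l2_inner f h + l2_inner g h"
  unfolding l2_inner_def
  by (subst suminf_add) (auto simp: ring_distribs intro: l2_summable_inner)

lemma l2_inner_scale_left:
  "\<lbrakk>f \<in> l2 X; h \<in> l2 X\<rbrakk> \<Longrightarrow> l2_inner (\<lambda>n. c * f n) h = c * l2_inner f h"
  unfolding l2_inner_def
  by (subst suminf_mult[symmetric]) (auto simp: mult.assoc intro: l2_summable_inner)

lemma l2_inner_diff_left:
  "\<lbrakk>f \<in> l2 X; g \<in> l2 X; h \<in> l2 X\<rbrakk> \<Longrightarrow> l2_inner (\<lambda>n. f n - g n) h = l2_inner f h - l2_inner g h"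
  using l2_inner_add_left[of f X "\<lambda>n. (-1) * g n" h] l2_inner_scale_left[of g X h "-1"]
  by simp

lemma l2_inner_zero_left [simp]: "l2_inner (\<lambda>n. 0) h = 0"
  by (simp add: l2_inner_def)

lemma l2_inner_sum_left:
  "(\<And>k. k \<in> K \<Longrightarrow> f k \<in> l2 X) \<Longrightarrow> h \<in> l2 X \<Longrightarrow>
    l2_inner (\<lambda>n. \<Sum>k\<in>K. f k n) h = (\<Sum>k\<in>K. l2_inner (f k) h)"
  by (induction K rule: infinite_finite_induct) (simp_all add: l2_inner_add_left[where X = X])

lemma l2_inner_cnj:
  assumes "f \<in> l2 X" "g \<in> l2 X"
  shows "l2_inner g f = cnj (l2_inner f g)"
proof -
  have "(\<lambda>n. f n * cnj (g n)) sums l2_inner f g"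
    unfolding l2_inner_def using l2_summable_inner[OF assms] by (rule summable_sums)
  then have "(\<lambda>n. cnj (f n * cnj (g n))) sums cnj (l2_inner f g)"
    by (subst sums_cnj)
  then show ?thesis by (simp add: l2_inner_def sums_iff mult.commute)
qed

lemma l2_norm_power2: "f \<in> l2 X \<Longrightarrow> (l2_norm f)\<^sup>2 = suminf (\<lambda>n. (cmod (f n))\<^sup>2)"
  by (simp add: l2_norm_def suminf_nonneg l2_summable)

lemma l2_norm_nonneg [simp]: "f \<in> l2 X \<Longrightarrow> 0 \<le> l2_norm f"
  by (simp add: l2_norm_def suminf_nonneg l2_summable)

lemma l2_inner_self:
  assumes "f \<in> l2 X"
  shows "l2_inner f f = of_real ((l2_norm f)\<^sup>2)"
proof -
  have "(\<lambda>n. of_real ((cmod (f n))\<^sup>2)) sums (of_real ((l2_norm f)\<^sup>2) :: complex)"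
    unfolding l2_norm_power2[OF assms] sums_of_real_iff
    using l2_summable[OF assms] by (rule summable_sums)
  then show ?thesis
    unfolding l2_inner_def by (simp add: sums_iff complex_norm_square[symmetric])
qed

lemma l2_norm_eq_0D:
  assumes "f \<in> l2 X" "l2_norm f = 0"
  shows "f = (\<lambda>n. 0)"
proof -
  have "suminf (\<lambda>n. (cmod (f n))\<^sup>2) = 0"
    using assms(2) l2_norm_power2[OF assms(1)] by simp
  then have "\<forall>n. (cmod (f n))\<^sup>2 = 0"
    by (subst (asm) suminf_eq_zero_iff) (auto intro: l2_summable assms)
  then show ?thesis by auto
qed

lemma l2_norm_zero [simp]: "l2_norm (\<lambda>n. 0) = 0"
  by (simp add: l2_norm_def)

lemma l2_norm_scale: "f \<in> l2 X \<Longrightarrow> l2_norm (\<lambda>n. c * f n) = cmod c * l2_norm f"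
  by (simp add: l2_norm_def norm_mult power_mult_distrib suminf_mult l2_summable real_sqrt_mult)

lemma L2_set_le_l2_norm:
  assumes "f \<in> l2 X"
  shows "L2_set (\<lambda>n. cmod (f n)) {..<N} \<le> l2_norm f"
  unfolding L2_set_def l2_norm_def
  using assms by (intro real_sqrt_le_mono sum_le_suminf l2_summable) auto

lemma l2_Cauchy_Schwarz:
  assumes f: "f \<in> l2 X" and g: "g \<in> l2 X"
  shows "cmod (l2_inner f g) \<le> l2_norm f * l2_norm g"
proof -
  have "cmod (l2_inner f g) \<le> suminf (\<lambda>n. cmod (f n * cnj (g n)))"
    unfolding l2_inner_def by (rule summable_norm[OF l2_summable_prod[OF f g]])
  also have "\<dots> \<le> l2_norm f * l2_norm g"
  proof (rule suminf_le_const[OF l2_summable_prod[OF f g]])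
    fix N
    have "(\<Sum>n<N. cmod (f n * cnj (g n))) = (\<Sum>n<N. \<bar>cmod (f n)\<bar> * \<bar>cmod (g n)\<bar>)"
      by (simp add: norm_mult)
    also have "\<dots> \<le> L2_set (\<lambda>n. cmod (f n)) {..<N} * L2_set (\<lambda>n. cmod (g n)) {..<N}"
      by (rule L2_set_mult_ineq)
    also have "\<dots> \<le> l2_norm f * l2_norm g"
      by (intro mult_mono L2_set_le_l2_norm[OF f] L2_set_le_l2_norm[OF g] l2_norm_nonneg[OF f]
          L2_set_nonneg)
    finally show "(\<Sum>n<N. cmod (f n * cnj (g n))) \<le> l2_norm f * l2_norm g" .
  qed
  finally show ?thesis .
qed

text \<open>
  The Cauchy-Schwarz inequality bounds squares of norms; this is how the bounds for norms come out of it.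
\<close>

lemma l2_norm_le_of_square:
  assumes "f \<in> l2 X" "0 \<le> K" "(l2_norm f)\<^sup>2 \<le> K * l2_norm f"
  shows "l2_norm f \<le> K"
proof (cases "l2_norm f = 0")
  case False
  then have "0 < l2_norm f" using l2_norm_nonneg[OF assms(1)] by simp
  then show ?thesis using assms(3) by (simp add: power2_eq_square)
qed (use assms in simp)

lemma l2_norm_triangle:
  assumes f: "f \<in> l2 X" and g: "g \<in> l2 X"
  shows "l2_norm (\<lambda>n. f n + g n) \<le> l2_norm f + l2_norm g"
proof -
  let ?h = "\<lambda>n. f n + g n"
  have h: "?h \<in> l2 X" using f g by simp
  have "(l2_norm ?h)\<^sup>2 = cmod (l2_inner ?h ?h)"
    by (simp only: l2_inner_self[OF h] norm_of_real abs_power2 abs_norm_cancel)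
  also have "\<dots> \<le> cmod (l2_inner f ?h) + cmod (l2_inner g ?h)"
    unfolding l2_inner_add_left[OF f g h] by (rule norm_triangle_ineq)
  also have "\<dots> \<le> (l2_norm f + l2_norm g) * l2_norm ?h"
    using l2_Cauchy_Schwarz[OF f h] l2_Cauchy_Schwarz[OF g h] by (simp add: distrib_right)
  finally show ?thesis
    using l2_norm_le_of_square[OF h] f g by simp
qed

lemma l2_norm_sum_le:
  "(\<And>k. k \<in> K \<Longrightarrow> h k \<in> l2 X) \<Longrightarrow> l2_norm (\<lambda>n. \<Sum>k\<in>K. h k n) \<le> (\<Sum>k\<in>K. l2_norm (h k))"
proof (induction K rule: infinite_finite_induct)
  case (insert k K)
  have "l2_norm (\<lambda>n. h k n + (\<Sum>k\<in>K. h k n)) \<le> l2_norm (h k) + l2_norm (\<lambda>n. \<Sum>k\<in>K. h k n)"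
    using insert by (intro l2_norm_triangle[where X = X] l2_sum) auto
  then show ?case using insert by simp
qed simp_all

section \<open>Cuntz-Krieger families of operators\<close>

abbreviation gens :: "'i set \<Rightarrow> 'i gen set" where
  "gens I \<equiv> Gen ` I \<union> Gen_star ` I"

locale ck_rep =
  fixes I :: "'i set" and A :: "'i \<Rightarrow> 'i \<Rightarrow> nat" and X :: "nat set"
    and T S :: "'i \<Rightarrow> l2_op"
  assumes finite_I: "finite I" and family: "ck_family I A X T S"
begin

abbreviation word_op :: "'i gen list \<Rightarrow> l2_op" where
  "word_op w \<equiv> foldr (gen_op T S) w"

abbreviation rep :: "'i ncpoly \<Rightarrow> l2_op" where
  "rep \<equiv> free_rep T S"

lemma gen_op_bounded: "g \<in> gens I \<Longrightarrow> bounded_op X (gen_op T S g)"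
  using family by (auto simp: ck_family_def)

lemma gen_op_l2 [simp]: "g \<in> gens I \<Longrightarrow> f \<in> l2 X \<Longrightarrow> gen_op T S g f \<in> l2 X"
  using gen_op_bounded by (auto simp: bounded_op_def)

lemma gen_op_add:
  "g \<in> gens I \<Longrightarrow> f \<in> l2 X \<Longrightarrow> h \<in> l2 X \<Longrightarrow>
    gen_op T S g (\<lambda>n. f n + h n) = (\<lambda>n. gen_op T S g f n + gen_op T S g h n)"
  using gen_op_bounded[of g] by (auto simp: bounded_op_def)

lemma gen_op_scale:
  "g \<in> gens I \<Longrightarrow> f \<in> l2 X \<Longrightarrow> gen_op T S g (\<lambda>n. c * f n) = (\<lambda>n. c * gen_op T S g f n)"
  using gen_op_bounded[of g] by (auto simp: bounded_op_def)

lemma T_l2 [simp]: "i \<in> I \<Longrightarrow> f \<in> l2 X \<Longrightarrow> T i f \<in> l2 X"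
  using gen_op_l2[of "Gen i"] by auto

lemma S_l2 [simp]: "i \<in> I \<Longrightarrow> f \<in> l2 X \<Longrightarrow> S i f \<in> l2 X"
  using gen_op_l2[of "Gen_star i"] by auto

lemma TST: "i \<in> I \<Longrightarrow> f \<in> l2 X \<Longrightarrow> T i (S i (T i f)) = T i f"
  using family by (auto simp: ck_family_def)

lemma sum_TS: "f \<in> l2 X \<Longrightarrow> (\<lambda>n. \<Sum>j\<in>I. T j (S j f) n) = f"
  using family by (auto simp: ck_family_def)

lemma ST_eq: "i \<in> I \<Longrightarrow> f \<in> l2 X \<Longrightarrow> S i (T i f) = (\<lambda>n. \<Sum>j\<in>I. of_nat (A i j) * T j (S j f) n)"
  using family by (auto simp: ck_family_def)

lemma adjoint_T: "i \<in> I \<Longrightarrow> f \<in> l2 X \<Longrightarrow> g \<in> l2 X \<Longrightarrow> l2_inner (T i f) g = l2_inner f (S i g)"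
  using family by (auto simp: ck_family_def is_adjoint_def)

lemma adjoint_S:
  assumes "i \<in> I" "f \<in> l2 X" "g \<in> l2 X"
  shows "l2_inner (S i f) g = l2_inner f (T i g)"
proof -
  have "l2_inner (S i f) g = cnj (l2_inner g (S i f))"
    using assms by (intro l2_inner_cnj[where X = X]) simp_all
  also have "\<dots> = cnj (l2_inner (T i g) f)" using assms by (simp add: adjoint_T)
  also have "\<dots> = l2_inner f (T i g)"
    using assms by (intro l2_inner_cnj[where X = X, symmetric]) simp_all
  finally show ?thesis .
qed

lemma gen_op_adjoint:
  "g \<in> gens I \<Longrightarrow> f \<in> l2 X \<Longrightarrow> h \<in> l2 X \<Longrightarrow>
    l2_inner (gen_op T S g f) h = l2_inner f (gen_op T S (gen_star g) h)"
  by (auto simp: adjoint_T adjoint_S)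

text \<open>
  Take the inner product of \<open>f = (\<Sum>j. T j (S j f))\<close> with \<open>f\<close>.  This identity makes all generators
  contractions, so that the universal seminorm is finite, and it makes their ranges orthogonal.
\<close>

lemma parseval:
  assumes f: "f \<in> l2 X"
  shows "(l2_norm f)\<^sup>2 = (\<Sum>j\<in>I. (l2_norm (S j f))\<^sup>2)"
proof -
  have "complex_of_real ((l2_norm f)\<^sup>2) = l2_inner (\<lambda>n. \<Sum>j\<in>I. T j (S j f) n) f"
    using f by (simp only: l2_inner_self sum_TS)
  also have "\<dots> = (\<Sum>j\<in>I. l2_inner (T j (S j f)) f)"
    using f by (intro l2_inner_sum_left[where X = X]) simp_all
  also have "\<dots> = (\<Sum>j\<in>I. complex_of_real ((l2_norm (S j f))\<^sup>2))"
    using f by (intro sum.cong refl) (simp add: adjoint_T l2_inner_self[where X = X])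
  also have "\<dots> = complex_of_real (\<Sum>j\<in>I. (l2_norm (S j f))\<^sup>2)"
    by simp
  finally show ?thesis by (simp only: of_real_eq_iff)
qed

lemma norm_S_le:
  assumes "i \<in> I" "f \<in> l2 X"
  shows "l2_norm (S i f) \<le> l2_norm f"
proof (rule power2_le_imp_le)
  show "(l2_norm (S i f))\<^sup>2 \<le> (l2_norm f)\<^sup>2"
    unfolding parseval[OF assms(2)]
    using assms finite_I by (intro member_le_sum) simp_all
qed (use assms in simp)

lemma norm_T_le:
  assumes "i \<in> I" "f \<in> l2 X"
  shows "l2_norm (T i f) \<le> l2_norm f"
proof (rule l2_norm_le_of_square[where X = X])
  have "(l2_norm (T i f))\<^sup>2 = cmod (l2_inner (T i f) (T i f))"
    using assms by (simp only: l2_inner_self[where X = X] T_l2 norm_of_real abs_power2)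
  also have "\<dots> = cmod (l2_inner f (S i (T i f)))"
    using assms by (simp add: adjoint_T)
  also have "\<dots> \<le> l2_norm f * l2_norm (S i (T i f))"
    using assms by (intro l2_Cauchy_Schwarz[where X = X]) simp_all
  also have "\<dots> \<le> l2_norm f * l2_norm (T i f)"
    using assms by (intro mult_left_mono norm_S_le) simp_all
  finally show "(l2_norm (T i f))\<^sup>2 \<le> l2_norm f * l2_norm (T i f)" .
qed (use assms in simp_all)

lemma gen_op_norm_le: "g \<in> gens I \<Longrightarrow> f \<in> l2 X \<Longrightarrow> l2_norm (gen_op T S g f) \<le> l2_norm f"
  by (auto simp: norm_S_le norm_T_le)

lemma word_op_l2 [simp]: "set w \<subseteq> gens I \<Longrightarrow> f \<in> l2 X \<Longrightarrow> word_op w f \<in> l2 X"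
  by (induction w) simp_all

lemma word_op_norm_le:
  assumes "set w \<subseteq> gens I" "f \<in> l2 X"
  shows "l2_norm (word_op w f) \<le> l2_norm f"
  using assms(1)
proof (induction w)
  case (Cons g w)
  then have "l2_norm (gen_op T S g (word_op w f)) \<le> l2_norm (word_op w f)"
    using assms(2) by (intro gen_op_norm_le) simp_all
  with Cons show ?case by simp
qed simp

lemma word_op_add:
  "set w \<subseteq> gens I \<Longrightarrow> f \<in> l2 X \<Longrightarrow> h \<in> l2 X \<Longrightarrow>
    word_op w (\<lambda>n. f n + h n) = (\<lambda>n. word_op w f n + word_op w h n)"
  by (induction w) (simp_all add: gen_op_add)

lemma word_op_scale:
  "set w \<subseteq> gens I \<Longrightarrow> f \<in> l2 X \<Longrightarrow> word_op w (\<lambda>n. c * f n) = (\<lambda>n. c * word_op w f n)"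
  by (induction w) (simp_all add: gen_op_scale)

lemma word_op_zero [simp]: "set w \<subseteq> gens I \<Longrightarrow> word_op w (\<lambda>n. 0) = (\<lambda>n. 0)"
  using word_op_scale[of w "\<lambda>n. 0" 0] by simp

lemma word_op_sum:
  "set w \<subseteq> gens I \<Longrightarrow> (\<And>k. k \<in> K \<Longrightarrow> h k \<in> l2 X) \<Longrightarrow>
    word_op w (\<lambda>n. \<Sum>k\<in>K. h k n) = (\<lambda>n. \<Sum>k\<in>K. word_op w (h k) n)"
  by (induction K rule: infinite_finite_induct) (simp_all add: word_op_add)

lemma word_op_adjoint:
  "set w \<subseteq> gens I \<Longrightarrow> f \<in> l2 X \<Longrightarrow> h \<in> l2 X \<Longrightarrow>
    l2_inner (word_op w f) h = l2_inner f (word_op (rev (map gen_star w)) h)"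
proof (induction w arbitrary: h)
  case (Cons g w)
  have "gen_star g \<in> gens I" using Cons.prems by auto
  then have "gen_op T S (gen_star g) h \<in> l2 X" using Cons.prems by (intro gen_op_l2)
  with Cons show ?case by (simp add: gen_op_adjoint del: gen_op.simps)
qed simp

text \<open>
  The sum defining \<open>free_rep\<close> runs over the support of the polynomial, which addition changes;
  enlarging the range of summation to a fixed finite set makes additivity visible.
\<close>

lemma rep_superset:
  assumes "finite B" "Poly_Mapping.keys p \<subseteq> B"
  shows "rep p f n = (\<Sum>w\<in>B. Poly_Mapping.lookup p w * word_op w f n)"
  unfolding free_rep_def
  using assms by (intro sum.mono_neutral_left) (auto simp: in_keys_iff)

lemma rep_add: "rep (p + q) f = (\<lambda>n. rep p f n + rep q f n)"
proof
  fix n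
  let ?B = "Poly_Mapping.keys p \<union> Poly_Mapping.keys q"
  have "Poly_Mapping.keys (p + q) \<subseteq> ?B" by (rule Poly_Mapping.keys_add)
  then show "rep (p + q) f n = rep p f n + rep q f n"
    by (simp add: rep_superset[of ?B] lookup_add ring_distribs sum.distrib)
qed

lemma rep_diff: "rep (p - q) f = (\<lambda>n. rep p f n - rep q f n)"
  using rep_add[of "p - q" q f] by (simp add: fun_eq_iff)

lemma rep_zero [simp]: "rep 0 f = (\<lambda>n. 0)"
  by (simp add: free_rep_def)

lemma rep_sum: "rep (\<Sum>k\<in>K. P k) f = (\<lambda>n. \<Sum>k\<in>K. rep (P k) f n)"
  by (induction K rule: infinite_finite_induct) (simp_all add: rep_add)

lemma rep_single [simp]: "rep (Poly_Mapping.single w c) f = (\<lambda>n. c * word_op w f n)"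
  by (simp add: free_rep_def)

lemma rep_l2 [simp]: "p \<in> free_carrier I \<Longrightarrow> f \<in> l2 X \<Longrightarrow> rep p f \<in> l2 X"
  unfolding free_rep_def by (auto simp: free_carrier_def)

lemma rep_scale:
  "p \<in> free_carrier I \<Longrightarrow> f \<in> l2 X \<Longrightarrow> rep p (\<lambda>n. c * f n) = (\<lambda>n. c * rep p f n)"
  unfolding free_rep_def
  by (auto simp: free_carrier_def word_op_scale sum_distrib_left mult.left_commute intro!: sum.cong)

lemma rep_diff_right:
  "p \<in> free_carrier I \<Longrightarrow> f \<in> l2 X \<Longrightarrow> h \<in> l2 X \<Longrightarrow>
    rep p (\<lambda>n. f n - h n) = (\<lambda>n. rep p f n - rep p h n)"
proof -
  assume p: "p \<in> free_carrier I" and f: "f \<in> l2 X" and h: "h \<in> l2 X"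
  have "word_op w (\<lambda>n. f n - h n) = (\<lambda>n. word_op w f n - word_op w h n)"
    if "w \<in> Poly_Mapping.keys p" for w
    using word_op_add[of w f "\<lambda>n. (-1) * h n"] word_op_scale[of w h "-1"] p f h that
    by (auto simp: free_carrier_def)
  then show ?thesis
    unfolding free_rep_def
    by (auto simp: ring_distribs sum_subtractf)
qed

lemma rep_norm_le:
  assumes p: "p \<in> free_carrier I" and f: "f \<in> l2 X"
  shows "l2_norm (rep p f) \<le> (\<Sum>w\<in>Poly_Mapping.keys p. cmod (Poly_Mapping.lookup p w)) * l2_norm f"
proof -
  have w: "set w \<subseteq> gens I" if "w \<in> Poly_Mapping.keys p" for w
    using p that by (auto simp: free_carrier_def)
  have "l2_norm (rep p f) \<le>
      (\<Sum>w\<in>Poly_Mapping.keys p. l2_norm (\<lambda>n. Poly_Mapping.lookup p w * word_op w f n))"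
    unfolding free_rep_def using w f by (intro l2_norm_sum_le[where X = X] l2_scale word_op_l2)
  also have "\<dots> \<le> (\<Sum>w\<in>Poly_Mapping.keys p. cmod (Poly_Mapping.lookup p w) * l2_norm f)"
  proof (rule sum_mono)
    fix v assume "v \<in> Poly_Mapping.keys p"
    then have v: "set v \<subseteq> gens I" by (rule w)
    then show "l2_norm (\<lambda>n. Poly_Mapping.lookup p v * word_op v f n)
        \<le> cmod (Poly_Mapping.lookup p v) * l2_norm f"
      using f by (subst l2_norm_scale[where X = X]) (auto intro!: mult_left_mono word_op_norm_le)
  qed
  finally show ?thesis by (simp add: sum_distrib_right)
qed

lemma rep_mult:
  assumes q: "q \<in> free_carrier I" and p: "p \<in> free_carrier I" and f: "f \<in> l2 X"
  shows "rep (free_mult p q) f = rep p (rep q f)"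
proof
  fix n
  have q': "set v \<subseteq> gens I" if "v \<in> Poly_Mapping.keys q" for v
    using q that by (auto simp: free_carrier_def)
  have p': "set v \<subseteq> gens I" if "v \<in> Poly_Mapping.keys p" for v
    using p that by (auto simp: free_carrier_def)
  have "word_op u (rep q f) n =
      (\<Sum>v\<in>Poly_Mapping.keys q. Poly_Mapping.lookup q v * word_op u (word_op v f) n)"
    if "set u \<subseteq> gens I" for u
    unfolding free_rep_def using that q' f
    by (simp add: word_op_sum word_op_scale)
  then show "rep (free_mult p q) f n = rep p (rep q f) n"
    unfolding free_mult_def rep_sum free_rep_def[of T S p] using p'
    by (simp add: sum_distrib_left mult.assoc)
qed

lemma rep_adjoint:
  assumes p: "p \<in> free_carrier I" and f: "f \<in> l2 X" and h: "h \<in> l2 X"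
  shows "l2_inner (rep p f) h = l2_inner f (rep (free_star p) h)"
proof -
  have w: "set w \<subseteq> gens I" if "w \<in> Poly_Mapping.keys p" for w
    using p that by (auto simp: free_carrier_def)
  have w': "set (rev (map gen_star w)) \<subseteq> gens I" if "w \<in> Poly_Mapping.keys p" for w
    using w[OF that] by fastforce
  let ?W = "\<lambda>w n. cnj (Poly_Mapping.lookup p w) * word_op (rev (map gen_star w)) h n"
  have W: "?W w \<in> l2 X" if "w \<in> Poly_Mapping.keys p" for w
    using w'[OF that] h by (intro l2_scale word_op_l2)
  have "l2_inner (rep p f) h =
      (\<Sum>w\<in>Poly_Mapping.keys p. Poly_Mapping.lookup p w * l2_inner (word_op w f) h)"
    unfolding free_rep_def using w f h
    by (subst l2_inner_sum_left[where X = X]) (auto simp: l2_inner_scale_left[where X = X])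
  also have "\<dots> = (\<Sum>w\<in>Poly_Mapping.keys p. cnj (l2_inner (?W w) f))"
  proof (rule sum.cong[OF refl])
    fix v assume v: "v \<in> Poly_Mapping.keys p"
    have l: "word_op (rev (map gen_star v)) h \<in> l2 X" using w'[OF v] h by (rule word_op_l2)
    have "l2_inner (word_op v f) h = l2_inner f (word_op (rev (map gen_star v)) h)"
      by (rule word_op_adjoint[OF w[OF v] f h])
    also have "\<dots> = cnj (l2_inner (word_op (rev (map gen_star v)) h) f)"
      by (rule l2_inner_cnj[OF l f])
    finally show "Poly_Mapping.lookup p v * l2_inner (word_op v f) h = cnj (l2_inner (?W v) f)"
      by (subst l2_inner_scale_left[OF l f]) simp
  qed
  also have "\<dots> = cnj (l2_inner (\<lambda>n. \<Sum>w\<in>Poly_Mapping.keys p. ?W w n) f)"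
    using W f by (subst l2_inner_sum_left[where X = X]) auto
  also have "(\<lambda>n. \<Sum>w\<in>Poly_Mapping.keys p. ?W w n) = rep (free_star p) h"
    by (rule ext) (simp add: free_star_def rep_sum)
  also have "cnj (l2_inner (rep (free_star p) h) f) = l2_inner f (rep (free_star p) h)"
  proof -
    have "rep (free_star p) h = (\<lambda>n. \<Sum>w\<in>Poly_Mapping.keys p. ?W w n)"
      by (rule ext) (simp add: free_star_def rep_sum)
    then have "rep (free_star p) h \<in> l2 X" using W by simp
    then show ?thesis using f by (intro l2_inner_cnj[symmetric])
  qed
  finally show ?thesis .
qed

lemma op_norm_rep_bounds:
  assumes p: "p \<in> free_carrier I"
  shows op_norm_rep: "f \<in> l2 X \<Longrightarrow> l2_norm (rep p f) \<le> op_norm X (rep p) * l2_norm f"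
    and op_norm_rep_le: "(\<And>f. f \<in> l2 X \<Longrightarrow> l2_norm (rep p f) \<le> K * l2_norm f) \<Longrightarrow> 0 \<le> K \<Longrightarrow>
      op_norm X (rep p) \<le> K"
    and op_norm_rep_nonneg: "0 \<le> op_norm X (rep p)"
proof -
  let ?N = "{l2_norm (rep p f) | f. f \<in> l2 X \<and> l2_norm f \<le> 1}"
  have ne: "?N \<noteq> {}" by (auto intro!: exI[of _ "\<lambda>n. 0"])
  let ?B = "\<Sum>w\<in>Poly_Mapping.keys p. cmod (Poly_Mapping.lookup p w)"
  have "0 \<le> ?B" by (simp add: sum_nonneg)
  have "l2_norm (rep p f) \<le> ?B" if "f \<in> l2 X" "l2_norm f \<le> 1" for f
    using rep_norm_le[OF p that(1)] mult_left_mono[OF that(2) \<open>0 \<le> ?B\<close>] by simp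
  then have bdd: "bdd_above ?N" by (intro bdd_aboveI[of _ ?B]) auto
  have "l2_norm (rep p (\<lambda>n. 0)) \<le> op_norm X (rep p)"
    unfolding op_norm_def by (intro cSup_upper bdd) (auto intro!: exI[of _ "\<lambda>n. 0"])
  then show "0 \<le> op_norm X (rep p)"
    using l2_norm_nonneg[of "rep p (\<lambda>n. 0)" X] p by simp
  show "l2_norm (rep p f) \<le> op_norm X (rep p) * l2_norm f" if f: "f \<in> l2 X" for f
  proof (cases "l2_norm f = 0")
    case True
    then show ?thesis using rep_norm_le[OF p f] by simp
  next
    case False
    then have pos: "0 < l2_norm f" using l2_norm_nonneg[OF f] by simp
    let ?g = "\<lambda>n. complex_of_real (1 / l2_norm f) * f n"
    have g: "?g \<in> l2 X" using f by (rule l2_scale)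
    have "l2_norm ?g = 1" using pos by (subst l2_norm_scale[OF f]) (simp add: norm_divide)
    then have "l2_norm (rep p ?g) \<le> op_norm X (rep p)"
      unfolding op_norm_def using g by (intro cSup_upper bdd) auto
    moreover have "l2_norm (rep p ?g) = l2_norm (rep p f) / l2_norm f"
      using p f pos by (simp only: rep_scale l2_norm_scale[where X = X] rep_l2) (simp add: norm_divide)
    ultimately have "l2_norm (rep p f) / l2_norm f \<le> op_norm X (rep p)" by (simp only:)
    then show ?thesis using pos by (simp add: pos_divide_le_eq)
  qed
  show "op_norm X (rep p) \<le> K" if K: "\<And>f. f \<in> l2 X \<Longrightarrow> l2_norm (rep p f) \<le> K * l2_norm f" "0 \<le> K"
    unfolding op_norm_def
  proof (rule cSup_least[OF ne])
    fix r assume "r \<in> ?N"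
    then obtain f where f: "f \<in> l2 X" "l2_norm f \<le> 1" "r = l2_norm (rep p f)" by auto
    then show "r \<le> K" using K(1)[OF f(1)] mult_left_mono[OF f(2) K(2)] by simp
  qed
qed

end

section \<open>The universal seminorm\<close>

text \<open>
  The zero space guarantees that the supremum in the universal seminorm is over a nonempty set.
\<close>

lemma ck_rep_zero: "finite I \<Longrightarrow> ck_rep I A {} (\<lambda>_ f. f) (\<lambda>_ f. f)"
proof -
  have "l2 {} = {\<lambda>n. 0}" by (auto simp: l2_def)
  moreover assume "finite I"
  ultimately show ?thesis
    by (auto simp: ck_rep_def ck_family_def bounded_op_def is_adjoint_def intro!: exI[of _ 1])
qed

lemma op_norm_le_univ_seminorm:
  assumes "ck_rep I A X T S" and p: "p \<in> free_carrier I"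
  shows "op_norm X (free_rep T S p) \<le> univ_seminorm I A p"
proof -
  interpret ck_rep I A X T S by fact
  let ?N = "{op_norm X (free_rep T S p) | X T S. ck_family I A X T S}"
  have "bdd_above ?N"
  proof (rule bdd_aboveI)
    fix r assume "r \<in> ?N"
    then obtain X T S where r: "r = op_norm X (free_rep T S p)" and "ck_family I A X T S" by auto
    then have rep: "ck_rep I A X T S" using finite_I by (simp add: ck_rep_def)
    show "r \<le> (\<Sum>w\<in>Poly_Mapping.keys p. cmod (Poly_Mapping.lookup p w))"
      unfolding r using ck_rep.rep_norm_le[OF rep p]
      by (intro ck_rep.op_norm_rep_le[OF rep p]) (simp_all add: sum_nonneg)
  qed
  then show ?thesis
    unfolding univ_seminorm_def using family by (intro cSup_upper) auto
qed

lemma univ_seminorm_rep: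
  assumes rep: "ck_rep I A X T S" and p: "p \<in> free_carrier I" and f: "f \<in> l2 X"
  shows "l2_norm (free_rep T S p f) \<le> univ_seminorm I A p * l2_norm f"
  using ck_rep.op_norm_rep[OF rep p f]
    mult_right_mono[OF op_norm_le_univ_seminorm[OF rep p] l2_norm_nonneg[OF f]]
  by simp

text \<open>
  The seminorm is the least common bound for all families: together with \<open>univ_seminorm_rep\<close> this
  reduces every inequality for it to one for the operators of a single family.
\<close>

lemma univ_seminorm_le:
  assumes fin: "finite I" and p: "p \<in> free_carrier I" and K: "0 \<le> K"
    and le: "\<And>X T S f. ck_rep I A X T S \<Longrightarrow> f \<in> l2 X \<Longrightarrow> l2_norm (free_rep T S p f) \<le> K * l2_norm f"
  shows "univ_seminorm I A p \<le> K"
  unfolding univ_seminorm_def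
proof (rule cSup_least)
  show "{op_norm X (free_rep T S p) | X T S. ck_family I A X T S} \<noteq> {}"
    using ck_rep_zero[OF fin, of A] by (auto simp: ck_rep_def)
  fix r assume "r \<in> {op_norm X (free_rep T S p) | X T S. ck_family I A X T S}"
  then obtain X T S where r: "r = op_norm X (free_rep T S p)" and "ck_family I A X T S" by auto
  then have rep: "ck_rep I A X T S" using fin by (simp add: ck_rep_def)
  show "r \<le> K" unfolding r using K le[OF rep] by (intro ck_rep.op_norm_rep_le[OF rep p])
qed

lemma free_carrier_zero [simp]: "0 \<in> free_carrier I"
  by (simp add: free_carrier_def)

lemma free_carrier_single [simp]: "set w \<subseteq> gens I \<Longrightarrow> Poly_Mapping.single w c \<in> free_carrier I"
  by (simp add: free_carrier_def)

lemma free_carrier_add [simp]: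
  "p \<in> free_carrier I \<Longrightarrow> q \<in> free_carrier I \<Longrightarrow> p + q \<in> free_carrier I"
  using Poly_Mapping.keys_add[of p q] by (auto simp: free_carrier_def)

lemma free_carrier_diff [simp]:
  "p \<in> free_carrier I \<Longrightarrow> q \<in> free_carrier I \<Longrightarrow> p - q \<in> free_carrier I"
  using free_carrier_add[of p I "- q"] by (simp add: free_carrier_def)

lemma free_carrier_sum [simp]:
  "(\<And>k. k \<in> K \<Longrightarrow> P k \<in> free_carrier I) \<Longrightarrow> (\<Sum>k\<in>K. P k) \<in> free_carrier I"
  by (induction K rule: infinite_finite_induct) simp_all

lemma free_carrier_mult [simp]:
  "p \<in> free_carrier I \<Longrightarrow> q \<in> free_carrier I \<Longrightarrow> free_mult p q \<in> free_carrier I"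
  unfolding free_mult_def
  by (intro free_carrier_sum free_carrier_single) (simp add: free_carrier_def)

lemma free_carrier_star [simp]:
  assumes "p \<in> free_carrier I" shows "free_star p \<in> free_carrier I"
  unfolding free_star_def
proof (intro free_carrier_sum free_carrier_single)
  fix w assume "w \<in> Poly_Mapping.keys p"
  then have "set w \<subseteq> gens I" using assms by (auto simp: free_carrier_def)
  then show "set (rev (map gen_star w)) \<subseteq> gens I" by fastforce
qed

context
  fixes I :: "'i set" and A :: "'i \<Rightarrow> 'i \<Rightarrow> nat"
  assumes fin: "finite I"
begin

lemma univ_seminorm_nonneg [simp]:
  "p \<in> free_carrier I \<Longrightarrow> 0 \<le> univ_seminorm I A p"
  using op_norm_le_univ_seminorm[OF ck_rep_zero[OF fin]] ck_rep.op_norm_rep_nonneg[OF ck_rep_zero[OF fin]]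
  by (rule order_trans[rotated])

lemma univ_seminorm_zero [simp]: "univ_seminorm I A 0 = 0"
proof (rule antisym)
  show "univ_seminorm I A 0 \<le> 0"
    by (rule univ_seminorm_le[OF fin]) (simp_all add: ck_rep.rep_zero)
qed simp

lemma univ_seminorm_add:
  assumes p: "p \<in> free_carrier I" and q: "q \<in> free_carrier I"
  shows "univ_seminorm I A (p + q) \<le> univ_seminorm I A p + univ_seminorm I A q"
proof (rule univ_seminorm_le[OF fin])
  fix X T S f assume rep: "ck_rep I A X T S" and f: "f \<in> l2 X"
  interpret ck_rep I A X T S by fact
  have "l2_norm (rep (p + q) f) = l2_norm (\<lambda>n. rep p f n + rep q f n)"
    by (simp add: rep_add)
  also have "\<dots> \<le> l2_norm (rep p f) + l2_norm (rep q f)"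
    using p q f by (intro l2_norm_triangle[where X = X] rep_l2)
  also have "\<dots> \<le> (univ_seminorm I A p + univ_seminorm I A q) * l2_norm f"
    using univ_seminorm_rep[OF rep p f] univ_seminorm_rep[OF rep q f] by (simp add: distrib_right)
  finally show "l2_norm (rep (p + q) f) \<le> (univ_seminorm I A p + univ_seminorm I A q) * l2_norm f" .
qed (use p q in simp_all)

lemma univ_seminorm_commute:
  assumes "p \<in> free_carrier I" "q \<in> free_carrier I"
  shows "univ_seminorm I A (p - q) = univ_seminorm I A (q - p)"
proof -
  have "univ_seminorm I A (p - q) \<le> univ_seminorm I A (q - p)"
    if p: "p \<in> free_carrier I" and q: "q \<in> free_carrier I" for p q
  proof (rule univ_seminorm_le[OF fin])
    fix X T S f assume rep: "ck_rep I A X T S" and f: "f \<in> l2 X"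
    interpret ck_rep I A X T S by fact
    have "rep (p - q) f = (\<lambda>n. -1 * rep (q - p) f n)" by (auto simp: rep_diff)
    then have "l2_norm (rep (p - q) f) = l2_norm (rep (q - p) f)"
      using p q f by (simp only: l2_norm_scale[where X = X] rep_l2 free_carrier_diff) simp
    with univ_seminorm_rep[OF rep _ f, of "q - p"] p q
    show "l2_norm (rep (p - q) f) \<le> univ_seminorm I A (q - p) * l2_norm f" by simp
  qed (use p q in simp_all)
  with assms show ?thesis by (intro antisym)
qed

lemma univ_seminorm_triangle:
  assumes "p \<in> free_carrier I" "q \<in> free_carrier I" "r \<in> free_carrier I"
  shows "univ_seminorm I A (p - r) \<le> univ_seminorm I A (p - q) + univ_seminorm I A (q - r)"
  using univ_seminorm_add[of "p - q" "q - r"] assms by simp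

text \<open>
  This is the estimate for \<open>p q - x y = (p - x) q + x (q - y)\<close>.  It makes multiplication compatible
  with passing to classes of Cauchy sequences.
\<close>

lemma univ_seminorm_mult_diff:
  assumes p: "p \<in> free_carrier I" and q: "q \<in> free_carrier I"
    and x: "x \<in> free_carrier I" and y: "y \<in> free_carrier I"
  shows "univ_seminorm I A (free_mult p q - free_mult x y) \<le>
    univ_seminorm I A (p - x) * univ_seminorm I A q + univ_seminorm I A x * univ_seminorm I A (q - y)"
    (is "_ \<le> ?K")
proof (rule univ_seminorm_le[OF fin])
  fix X T S f assume rep: "ck_rep I A X T S" and f: "f \<in> l2 X"
  interpret ck_rep I A X T S by fact
  have "rep (free_mult p q - free_mult x y) f =
      (\<lambda>n. rep (p - x) (rep q f) n + rep x (rep (q - y) f) n)"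
  proof -
    have "rep (q - y) f = (\<lambda>n. rep q f n - rep y f n)" by (simp add: rep_diff)
    then have "rep x (rep (q - y) f) = (\<lambda>n. rep x (rep q f) n - rep x (rep y f) n)"
      using x q y f by (simp add: rep_diff_right)
    then show ?thesis using p q x y f by (auto simp: rep_diff rep_mult)
  qed
  then have "l2_norm (rep (free_mult p q - free_mult x y) f) \<le>
      l2_norm (rep (p - x) (rep q f)) + l2_norm (rep x (rep (q - y) f))"
    using p q x y f by (simp add: l2_norm_triangle[where X = X])
  also have "\<dots> \<le> univ_seminorm I A (p - x) * l2_norm (rep q f)
      + univ_seminorm I A x * l2_norm (rep (q - y) f)"
    using p q x y f by (intro add_mono univ_seminorm_rep[OF rep]) simp_all
  also have "\<dots> \<le> univ_seminorm I A (p - x) * (univ_seminorm I A q * l2_norm f)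
      + univ_seminorm I A x * (univ_seminorm I A (q - y) * l2_norm f)"
    using p q x y f by (intro add_mono mult_left_mono univ_seminorm_rep[OF rep]) simp_all
  finally show "l2_norm (rep (free_mult p q - free_mult x y) f) \<le> ?K * l2_norm f"
    by (simp add: algebra_simps)
qed (use p q x y in simp_all)

text \<open>
  An operator and its adjoint have the same norm.
\<close>

lemma univ_seminorm_star_diff:
  assumes p: "p \<in> free_carrier I" and x: "x \<in> free_carrier I"
  shows "univ_seminorm I A (free_star p - free_star x) \<le> univ_seminorm I A (p - x)"
proof (rule univ_seminorm_le[OF fin])
  fix X T S f assume rep: "ck_rep I A X T S" and f: "f \<in> l2 X"
  interpret ck_rep I A X T S by fact
  let ?h = "rep (free_star p - free_star x) f"
  have h: "?h \<in> l2 X" using p x f by simp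
  \<comment> \<open>The adjoint turns \<open>?h\<close> into an operator applied to the other argument; at \<open>h = ?h\<close> the left side is
    the square of the norm.\<close>
  have "l2_inner h ?h = l2_inner (rep (p - x) h) f" if h: "h \<in> l2 X" for h
  proof -
    have "l2_inner h ?h = cnj (l2_inner ?h h)"
      using p x f h by (intro l2_inner_cnj[where X = X]) simp_all
    also have "\<dots> = cnj (l2_inner (rep (free_star p) f) h) - cnj (l2_inner (rep (free_star x) f) h)"
      using p x f h by (simp add: rep_diff l2_inner_diff_left[where X = X])
    also have "\<dots> = l2_inner h (rep (free_star p) f) - l2_inner h (rep (free_star x) f)"
      using p x f h by (simp add: l2_inner_cnj[where X = X, symmetric])
    also have "\<dots> = l2_inner (rep p h) f - l2_inner (rep x h) f"
      using p x f h by (simp add: rep_adjoint)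
    also have "\<dots> = l2_inner (rep (p - x) h) f"
      using p x f h by (simp add: rep_diff l2_inner_diff_left[where X = X])
    finally show ?thesis .
  qed
  then have "l2_inner ?h ?h = l2_inner (rep (p - x) ?h) f" using h .
  then have "(l2_norm ?h)\<^sup>2 = cmod (l2_inner (rep (p - x) ?h) f)"
    unfolding l2_inner_self[OF h] by (metis abs_power2 norm_of_real)
  also have "\<dots> \<le> l2_norm (rep (p - x) ?h) * l2_norm f"
    using p x h f by (intro l2_Cauchy_Schwarz[where X = X]) simp_all
  also have "\<dots> \<le> (univ_seminorm I A (p - x) * l2_norm ?h) * l2_norm f"
    using p x h f by (intro mult_right_mono univ_seminorm_rep[OF rep]) simp_all
  finally show "l2_norm ?h \<le> univ_seminorm I A (p - x) * l2_norm f"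
    using p x f by (intro l2_norm_le_of_square[OF h]) (simp_all add: mult_ac)
qed (use p x in simp_all)

section \<open>Words in the Cuntz-Krieger algebra\<close>

text \<open>
  The operations of the algebra are unions over all representatives of the classes.  Such a union is a
  single class because the sequences computed from different representatives have distance tending
  to 0.
\<close>

lemma ck_class_eqI:
  assumes x: "\<And>n. x n \<in> free_carrier I" and y: "\<And>n. y n \<in> free_carrier I"
    and lim: "(\<lambda>n. univ_seminorm I A (x n - y n)) \<longlonglongrightarrow> 0"
  shows "ck_class I A x = ck_class I A y"
proof -
  have "z \<in> ck_class I A y"
    if "z \<in> ck_class I A x" and x: "\<And>n. x n \<in> free_carrier I" and y: "\<And>n. y n \<in> free_carrier I"
      and lim: "(\<lambda>n. univ_seminorm I A (x n - y n)) \<longlonglongrightarrow> 0" for x y z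
  proof -
    have z: "ck_Cauchy I A z" "(\<lambda>n. univ_seminorm I A (x n - z n)) \<longlonglongrightarrow> 0"
      using that by (simp_all add: ck_class_def)
    then have zc: "z n \<in> free_carrier I" for n by (simp add: ck_Cauchy_def)
    have "(\<lambda>n. univ_seminorm I A (y n - z n)) \<longlonglongrightarrow> 0"
    proof (rule tendsto_sandwich[OF _ _ tendsto_const])
      show "(\<lambda>n. univ_seminorm I A (x n - y n) + univ_seminorm I A (x n - z n)) \<longlonglongrightarrow> 0"
        using tendsto_add[OF lim z(2)] by simp
      show "\<forall>\<^sub>F n in sequentially. univ_seminorm I A (y n - z n)
          \<le> univ_seminorm I A (x n - y n) + univ_seminorm I A (x n - z n)"
        using univ_seminorm_triangle[of "y _" "x _" "z _"] x y zc
        by (simp add: univ_seminorm_commute[of "x _" "y _"])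
    qed (use y zc in simp_all)
    with z(1) show ?thesis by (simp add: ck_class_def)
  qed
  note sub = this
  have lim': "(\<lambda>n. univ_seminorm I A (y n - x n)) \<longlonglongrightarrow> 0"
    using lim by (simp only: univ_seminorm_commute[OF x y])
  show ?thesis
  proof (rule subset_antisym; rule subsetI)
    show "z \<in> ck_class I A y" if "z \<in> ck_class I A x" for z
      by (rule sub[where x = x and y = y]) (use that x y lim in auto)
    show "z \<in> ck_class I A x" if "z \<in> ck_class I A y" for z
      by (rule sub[where x = y and y = x]) (use that x y lim' in auto)
  qed
qed

abbreviation const_class :: "'i ncpoly \<Rightarrow> (nat \<Rightarrow> 'i ncpoly) set" where
  "const_class p \<equiv> ck_class I A (\<lambda>_. p)"

lemma const_in_class: "p \<in> free_carrier I \<Longrightarrow> (\<lambda>_. p) \<in> const_class p"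
  by (simp add: ck_class_def ck_Cauchy_def)

lemma const_classD:
  assumes "x \<in> const_class p"
  shows "x n \<in> free_carrier I" "(\<lambda>n. univ_seminorm I A (p - x n)) \<longlonglongrightarrow> 0"
  using assms by (simp_all add: ck_class_def ck_Cauchy_def)

text \<open>
  Words in the generators only involve classes of constant sequences, so the operations are computed for
  these alone.
\<close>

lemma mult_const_class:
  assumes p: "p \<in> free_carrier I" and q: "q \<in> free_carrier I"
  shows "const_class p \<otimes>\<^bsub>cuntz_krieger I A\<^esub> const_class q = const_class (free_mult p q)"
proof -
  have "ck_class I A (\<lambda>n. free_mult (x n) (y n)) = const_class (free_mult p q)"
    if xy: "x \<in> const_class p" "y \<in> const_class q" for x y
  proof (rule ck_class_eqI[symmetric])
    note x = const_classD[OF xy(1)] and y = const_classD[OF xy(2)]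
    let ?N = "univ_seminorm I A"
    have "(\<lambda>n. ?N (p - x n) * ?N q + (?N p + ?N (p - x n)) * ?N (q - y n)) \<longlonglongrightarrow>
        0 * ?N q + (?N p + 0) * 0"
      by (intro tendsto_intros x(2) y(2))
    then have lim: "(\<lambda>n. ?N (p - x n) * ?N q + (?N p + ?N (p - x n)) * ?N (q - y n)) \<longlonglongrightarrow> 0"
      by simp
    have "?N (free_mult p q - free_mult (x n) (y n))
        \<le> ?N (p - x n) * ?N q + (?N p + ?N (p - x n)) * ?N (q - y n)" for n
    proof -
      have "?N (x n) \<le> ?N p + ?N (p - x n)"
        using univ_seminorm_triangle[of "x n" p 0] p x(1) univ_seminorm_commute[OF p x(1)] by simp
      then have "?N (x n) * ?N (q - y n) \<le> (?N p + ?N (p - x n)) * ?N (q - y n)"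
        using q y(1) by (intro mult_right_mono) simp_all
      with univ_seminorm_mult_diff[OF p q x(1) y(1), of n n] show ?thesis by simp
    qed
    then show "(\<lambda>n. ?N (free_mult p q - free_mult (x n) (y n))) \<longlonglongrightarrow> 0"
      using p q x(1) y(1) by (intro tendsto_sandwich[OF _ _ tendsto_const lim]) simp_all
  qed (use p q const_classD(1)[OF xy(1)] const_classD(1)[OF xy(2)] in simp_all)
  then have "const_class p \<otimes>\<^bsub>cuntz_krieger I A\<^esub> const_class q =
      (\<Union>x\<in>const_class p. \<Union>y\<in>const_class q. const_class (free_mult p q))"
    by (simp add: cuntz_krieger_def)
  also have "\<dots> = const_class (free_mult p q)"
    using const_in_class[OF p] const_in_class[OF q] by (simp add: ex_in_conv[symmetric]) blast
  finally show ?thesis .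
qed

lemma star_const_class:
  assumes p: "p \<in> free_carrier I"
  shows "cstar (cuntz_krieger I A) (const_class p) = const_class (free_star p)"
proof -
  have "ck_class I A (\<lambda>n. free_star (x n)) = const_class (free_star p)"
    if x: "x \<in> const_class p" for x
  proof (rule ck_class_eqI[symmetric])
    note x = const_classD[OF x]
    show "(\<lambda>n. univ_seminorm I A (free_star p - free_star (x n))) \<longlonglongrightarrow> 0"
      using p x(1) univ_seminorm_star_diff[OF p x(1)]
      by (intro tendsto_sandwich[OF _ _ tendsto_const x(2)]) simp_all
  qed (use p const_classD(1)[OF x] in simp_all)
  then have "cstar (cuntz_krieger I A) (const_class p) = (\<Union>x\<in>const_class p. const_class (free_star p))"
    by (simp add: cuntz_krieger_def)
  also have "\<dots> = const_class (free_star p)"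
    using const_in_class[OF p] by blast
  finally show ?thesis .
qed

lemma const_class_eq_zero_iff:
  assumes p: "p \<in> free_carrier I"
  shows "const_class p = \<zero>\<^bsub>cuntz_krieger I A\<^esub> \<longleftrightarrow> univ_seminorm I A p = 0"
proof
  assume "const_class p = \<zero>\<^bsub>cuntz_krieger I A\<^esub>"
  then have "(\<lambda>_. p) \<in> const_class 0"
    using const_in_class[OF p] by (simp add: cuntz_krieger_def)
  then have "(\<lambda>n::nat. univ_seminorm I A (0 - p)) \<longlonglongrightarrow> 0"
    by (rule const_classD(2))
  then show "univ_seminorm I A p = 0"
    using univ_seminorm_commute[of 0 p] p by (simp add: LIMSEQ_const_iff)
next
  assume "univ_seminorm I A p = 0"
  then show "const_class p = \<zero>\<^bsub>cuntz_krieger I A\<^esub>"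
    using p ck_class_eqI[of "\<lambda>_. p" "\<lambda>_. 0"] by (simp add: cuntz_krieger_def)
qed

end

primrec letter_gen :: "'i letter \<Rightarrow> 'i gen" where
  "letter_gen (Alpha i) = Gen_star i"
| "letter_gen (Beta i) = Gen i"

text \<open>
  The product of the generators in the algebra is the class of the constant sequence at the word, and that
  class is zero if and only if the universal seminorm of the word is.
\<close>

lemma forbidden_iff_word_op_zero:
  assumes fin: "finite I" and w: "set w \<subseteq> Alpha ` I \<union> Beta ` I"
  shows "forbidden I A w \<longleftrightarrow>
    (\<forall>X T S. ck_rep I A X T S \<longrightarrow> (\<forall>f \<in> l2 X. foldr (gen_op T S) (map letter_gen w) f = (\<lambda>n. 0)))"
proof -
  have gens: "set (map letter_gen w) \<subseteq> gens I" if "set w \<subseteq> Alpha ` I \<union> Beta ` I" for w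
    using that by fastforce
  have phi: "ck_phi I A g = ck_class I A (\<lambda>_. Poly_Mapping.single [letter_gen g] 1)"
    if "g \<in> Alpha ` I \<union> Beta ` I" for g
    using that
    by (auto simp: ck_gen_def free_gen_def star_const_class[OF fin] free_star_def)
  have fold: "foldr (\<lambda>g a. ck_phi I A g \<otimes>\<^bsub>cuntz_krieger I A\<^esub> a) w \<one>\<^bsub>cuntz_krieger I A\<^esub>
      = ck_class I A (\<lambda>_. Poly_Mapping.single (map letter_gen w) 1)"
    if "set w \<subseteq> Alpha ` I \<union> Beta ` I" for w
    using that
  proof (induction w)
    case Nil
    then show ?case by (simp add: cuntz_krieger_def free_one_def)
  next
    case (Cons g w)
    then show ?case
      using gens[of "[g]"] gens[of w] by (simp add: phi mult_const_class[OF fin] free_mult_def)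
  qed
  have c: "Poly_Mapping.single (map letter_gen w) 1 \<in> free_carrier I"
    using gens[OF w] by simp
  have "forbidden I A w \<longleftrightarrow> univ_seminorm I A (Poly_Mapping.single (map letter_gen w) 1) = 0"
    unfolding forbidden_def fold[OF w] by (rule const_class_eq_zero_iff[OF fin c])
  also have "\<dots> \<longleftrightarrow>
    (\<forall>X T S. ck_rep I A X T S \<longrightarrow> (\<forall>f \<in> l2 X. foldr (gen_op T S) (map letter_gen w) f = (\<lambda>n. 0)))"
    (is "?N = 0 \<longleftrightarrow> ?R")
  proof
    assume N: "?N = 0"
    show ?R
    proof (intro allI impI ballI)
      fix X T S f assume rep: "ck_rep I A X T S" and f: "f \<in> l2 X"
      have "l2_norm (foldr (gen_op T S) (map letter_gen w) f) \<le> ?N * l2_norm f"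
        using univ_seminorm_rep[OF rep c f] by (simp add: ck_rep.rep_single[OF rep])
      moreover have l: "foldr (gen_op T S) (map letter_gen w) f \<in> l2 X"
        using gens[OF w] f by (rule ck_rep.word_op_l2[OF rep])
      ultimately show "foldr (gen_op T S) (map letter_gen w) f = (\<lambda>n. 0)"
        using l2_norm_nonneg[OF l] N by (intro l2_norm_eq_0D[OF l]) simp
    qed
  next
    assume R: ?R
    have "?N \<le> 0"
    proof (rule univ_seminorm_le[OF fin c])
      fix X T S f assume rep: "ck_rep I A X T S" and f: "f \<in> l2 X"
      then have "foldr (gen_op T S) (map letter_gen w) f = (\<lambda>n. 0)" using R by blast
      then show "l2_norm (free_rep T S (Poly_Mapping.single (map letter_gen w) 1) f) \<le> 0 * l2_norm f"
        by (simp add: ck_rep.rep_single[OF rep])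
    qed simp
    then show "?N = 0" using univ_seminorm_nonneg[OF fin c, of A] by simp
  qed
  finally show ?thesis .
qed

section \<open>Letters acting on infinite paths\<close>

definition paths :: "'i set \<Rightarrow> ('i \<Rightarrow> 'i \<Rightarrow> nat) \<Rightarrow> (nat \<Rightarrow> 'i) set" where
  "paths I A = {x. \<forall>n. x n \<in> I \<and> A (x n) (x (Suc n)) \<noteq> 0}"

text \<open>
  \<open>path_step A (Alpha i)\<close> is the converse of \<open>path_step A (Beta i)\<close>, as \<open>S i\<close> is the adjoint of \<open>T i\<close>.
\<close>

primrec path_step :: "('i \<Rightarrow> 'i \<Rightarrow> nat) \<Rightarrow> 'i letter \<Rightarrow> (nat \<Rightarrow> 'i) \<Rightarrow> (nat \<Rightarrow> 'i) \<Rightarrow> bool" where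
  "path_step A (Alpha i) x y \<longleftrightarrow> A i (y 0) \<noteq> 0 \<and> x = case_nat i y"
| "path_step A (Beta i) x y \<longleftrightarrow> A i (x 0) \<noteq> 0 \<and> y = case_nat i x"

text \<open>
  The last letter acts first, as in a product of operators.
\<close>

primrec path_run :: "('i \<Rightarrow> 'i \<Rightarrow> nat) \<Rightarrow> 'i letter list \<Rightarrow> (nat \<Rightarrow> 'i) \<Rightarrow> (nat \<Rightarrow> 'i) \<Rightarrow> bool" where
  "path_run A [] x y \<longleftrightarrow> x = y"
| "path_run A (g # w) x y \<longleftrightarrow> (\<exists>z. path_run A w x z \<and> path_step A g z y)"

abbreviation letters :: "'i set \<Rightarrow> 'i letter set" where
  "letters I \<equiv> Alpha ` I \<union> Beta ` I"

lemma paths_cons: "x \<in> paths I A \<Longrightarrow> i \<in> I \<Longrightarrow> A i (x 0) \<noteq> 0 \<Longrightarrow> case_nat i x \<in> paths I A"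
  by (auto simp: paths_def split: nat.split)

lemma paths_tail: "x \<in> paths I A \<Longrightarrow> (\<lambda>n. x (Suc n)) \<in> paths I A"
  by (auto simp: paths_def)

lemma case_nat_eta: "case_nat (x 0) (\<lambda>n. x (Suc n)) = x"
  by (auto simp: fun_eq_iff split: nat.split)

lemma path_step_paths:
  assumes "g \<in> letters I" "x \<in> paths I A" "path_step A g x y"
  shows "y \<in> paths I A"
  using assms paths_cons[of x I A] paths_tail[of x I A] by auto

lemma path_run_paths:
  "set w \<subseteq> letters I \<Longrightarrow> x \<in> paths I A \<Longrightarrow> path_run A w x y \<Longrightarrow> y \<in> paths I A"
  by (induction w arbitrary: y) (auto intro: path_step_paths)

section \<open>Words that annihilate every path vanish in every Cuntz-Krieger family\<close>

context ck_rep
begin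

text \<open>
  By \<open>parseval\<close> the square of the norm of \<open>T k f\<close> is the sum of those of all \<open>S i (T k f)\<close>.  The term for
  \<open>i = k\<close> is already all of it, so the others vanish.
\<close>

lemma S_T_ne:
  assumes "j \<in> I" "k \<in> I" "j \<noteq> k" "f \<in> l2 X"
  shows "S j (T k f) = (\<lambda>n. 0)"
proof (rule l2_norm_eq_0D[where X = X])
  let ?N = "\<lambda>i. (l2_norm (S i (T k f)))\<^sup>2"
  have "complex_of_real (?N k) = l2_inner (S k (T k f)) (S k (T k f))"
    using assms by (simp add: l2_inner_self[where X = X])
  also have "\<dots> = l2_inner (T k f) (T k f)"
    using assms by (simp add: adjoint_S TST)
  also have "\<dots> = complex_of_real ((l2_norm (T k f))\<^sup>2)"
    using assms by (simp add: l2_inner_self[where X = X])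
  finally have "?N k = (\<Sum>i\<in>I. ?N i)"
    using parseval[of "T k f"] assms by (simp only: of_real_eq_iff T_l2)
  also have "\<dots> = ?N k + (\<Sum>i\<in>I - {k}. ?N i)"
    using finite_I assms by (intro sum.remove)
  also have "?N k + ?N j \<le> \<dots>"
    using finite_I assms by (intro add_left_mono member_le_sum) auto
  finally show "l2_norm (S j (T k f)) = 0" by simp
qed (use assms in simp)

lemma T_zero [simp]: "i \<in> I \<Longrightarrow> T i (\<lambda>n. 0) = (\<lambda>n. 0)"
  using word_op_zero[of "[Gen i]"] by simp

lemma S_T_T:
  assumes "i \<in> I" "j \<in> I" "f \<in> l2 X"
  shows "S i (T i (T j f)) = (\<lambda>n. of_nat (A i j) * T j f n)"
proof -
  have "S i (T i (T j f)) = (\<lambda>n. \<Sum>k\<in>I. of_nat (A i k) * T k (S k (T j f)) n)"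
    using assms by (simp add: ST_eq)
  also have "\<dots> = (\<lambda>n. of_nat (A i j) * T j (S j (T j f)) n)"
  proof
    fix n
    have "(\<Sum>k\<in>I. of_nat (A i k) * T k (S k (T j f)) n) =
        (\<Sum>k\<in>{j}. of_nat (A i k) * T k (S k (T j f)) n)"
      using assms finite_I by (intro sum.mono_neutral_right) (auto simp: S_T_ne)
    then show "(\<Sum>k\<in>I. of_nat (A i k) * T k (S k (T j f)) n) = of_nat (A i j) * T j (S j (T j f)) n"
      by simp
  qed
  finally show ?thesis using assms by (simp add: TST)
qed

lemma T_T_zero:
  assumes "i \<in> I" "j \<in> I" "f \<in> l2 X" "A i j = 0"
  shows "T i (T j f) = (\<lambda>n. 0)"
  using TST[of i "T j f"] S_T_T[of i j f] assms by simp

abbreviation prefix_op :: "(nat \<Rightarrow> 'i) \<Rightarrow> nat \<Rightarrow> l2_op" where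
  "prefix_op x m \<equiv> word_op (map (\<lambda>k. Gen (x k)) [0..<m])"

lemma prefix_op_l2 [simp]: "(\<And>k. x k \<in> I) \<Longrightarrow> g \<in> l2 X \<Longrightarrow> prefix_op x m g \<in> l2 X"
  by (intro word_op_l2) auto

lemma prefix_op_Suc: "prefix_op x (Suc m) g = T (x 0) (prefix_op (\<lambda>k. x (Suc k)) m g)"
  by (simp add: map_upt_Suc del: upt_Suc)

text \<open>
  In a Cuntz-Krieger family a word acts on \<open>T (x 0) \<dots> T (x (m - 1))\<close> as it acts on the path \<open>x\<close>, provided
  that \<open>m\<close> exceeds the number of letters which the word consumes.  The numbers \<open>a\<close> and \<open>b\<close> absorb this
  bound and the change of length.
\<close>

lemma word_op_prefix_op:
  assumes A: "\<And>i j. i \<in> I \<Longrightarrow> j \<in> I \<Longrightarrow> A i j \<le> 1"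
    and w: "set w \<subseteq> letters I" and x: "x \<in> paths I A"
  shows "(\<exists>y a b. path_run A w x y \<and> (\<forall>m. \<forall>g \<in> l2 X.
           word_op (map letter_gen w) (prefix_op x (m + a) g) = prefix_op y (m + b) g)) \<or>
         (\<exists>a. \<forall>m. \<forall>g \<in> l2 X.
           word_op (map letter_gen w) (prefix_op x (m + a) g) = (\<lambda>n. 0))"
    (is "?run w \<or> ?zero w")
  using w
proof (induction w)
  case Nil
  have "?run []" by (auto intro!: exI[of _ "0::nat"])
  then show ?case ..
next
  case (Cons c w)
  from Cons have "?run w \<or> ?zero w" by simp
  then show ?case
  proof
    assume "?zero w"
    then obtain a where a: "word_op (map letter_gen w) (prefix_op x (m + a) g) = (\<lambda>n. 0)"
      if "g \<in> l2 X" for m g by blast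
    have "gen_op T S (letter_gen c) (\<lambda>n. 0) = (\<lambda>n. 0)"
      using Cons.prems word_op_zero[of "[letter_gen c]"] by auto
    then have "?zero (c # w)" by (auto simp: a intro!: exI[of _ a])
    then show ?case ..
  next
    assume "?run w"
    then obtain y a b where run: "path_run A w x y"
      and "\<forall>m. \<forall>g \<in> l2 X. word_op (map letter_gen w) (prefix_op x (m + a) g) = prefix_op y (m + b) g"
      by blast
    then have ab: "word_op (map letter_gen w) (prefix_op x (m + a) g) = prefix_op y (m + b) g"
      if "g \<in> l2 X" for m g using that by blast
    have y: "y \<in> paths I A" using path_run_paths[OF _ x run] Cons.prems by simp
    then have yI: "y k \<in> I" for k by (simp add: paths_def)
    show ?case
    proof (cases c)
      case (Beta i)
      with Cons.prems have i: "i \<in> I" by auto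
      show ?thesis
      proof (cases "A i (y 0) = 0")
        case True
        have "word_op (map letter_gen (c # w)) (prefix_op x (m + Suc a) g) = (\<lambda>n. 0)"
          if "g \<in> l2 X" for m g
          using ab[OF that, of "Suc m"] True i yI that
          by (simp add: Beta prefix_op_Suc T_T_zero del: upt_Suc)
        then have "?zero (c # w)" by blast
        then show ?thesis ..
      next
        case False
        have "word_op (map letter_gen (c # w)) (prefix_op x (m + a) g)
            = prefix_op (case_nat i y) (m + Suc b) g" if "g \<in> l2 X" for m g
          using ab[OF that, of m] by (simp add: Beta prefix_op_Suc del: upt_Suc)
        moreover have "path_run A (c # w) x (case_nat i y)"
          using run False Beta by auto
        ultimately have "?run (c # w)" by blast
        then show ?thesis ..
      qed
    next
      case (Alpha i)
      with Cons.prems have i: "i \<in> I" by auto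
      show ?thesis
      proof (cases "y 0 = i")
        case False
        have "word_op (map letter_gen (c # w)) (prefix_op x (m + Suc a) g) = (\<lambda>n. 0)"
          if "g \<in> l2 X" for m g
          using ab[OF that, of "Suc m"] False i yI that
          by (simp add: Alpha prefix_op_Suc S_T_ne del: upt_Suc)
        then have "?zero (c # w)" by blast
        then show ?thesis ..
      next
        case True
        have nz: "A i (y (Suc 0)) \<noteq> 0" using y True by (auto simp: paths_def)
        then have one: "A i (y (Suc 0)) = 1" using A[OF i yI[of "Suc 0"]] by simp
        \<comment> \<open>Two more letters of the prefix: one is removed, the next one makes \<open>S i\<close> undo \<open>T i\<close>.\<close>
        have "word_op (map letter_gen (c # w)) (prefix_op x (m + (Suc (Suc a))) g)
            = prefix_op (\<lambda>n. y (Suc n)) (m + Suc b) g" if "g \<in> l2 X" for m g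
          using ab[OF that, of "Suc (Suc m)"] True i yI that one
          by (simp add: Alpha prefix_op_Suc S_T_T del: upt_Suc)
        moreover have "path_run A (c # w) x (\<lambda>n. y (Suc n))"
          using run True Alpha nz case_nat_eta[of y] by auto
        ultimately have "?run (c # w)" by blast
        then show ?thesis ..
      qed
    qed
  qed
qed

text \<open>
  The sequence is chosen one term at a time: if the word is nonzero at \<open>T (x 0) \<dots> T (x (m - 1)) h\<close>, then
  \<open>h = (\<Sum>j. T j (S j h))\<close> shows that for some \<open>j\<close> it is still nonzero with \<open>T j (S j h)\<close> in place
  of \<open>h\<close>.
\<close>

lemma nonzero_along_sequence:
  assumes w: "set w \<subseteq> gens I" and f: "f \<in> l2 X" and nz: "word_op w f \<noteq> (\<lambda>n. 0)"
  shows "\<exists>x. (\<forall>k. x k \<in> I) \<and> (\<forall>m. \<exists>g \<in> l2 X. word_op w (prefix_op x m g) \<noteq> (\<lambda>n. 0))"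
proof -
  define P where "P n s \<longleftrightarrow> length (fst s) = n \<and> set (fst s) \<subseteq> I \<and> snd s \<in> l2 X \<and>
    word_op w (word_op (map Gen (fst s)) (snd s)) \<noteq> (\<lambda>n. 0)" for n and s :: "'i list \<times> (nat \<Rightarrow> complex)"
  define Q where "Q n s s' \<longleftrightarrow> (\<exists>j. fst s' = fst s @ [j])"
    for n :: nat and s s' :: "'i list \<times> (nat \<Rightarrow> complex)"
  have "\<exists>s. \<forall>n. P n (s n) \<and> Q n (s n) (s (Suc n))"
  proof (rule dependent_nat_choice)
    show "\<exists>s. P 0 s" using f nz by (auto simp: P_def intro!: exI[of _ "([], f)"])
    fix s n assume s: "P n s"
    obtain l h where lh: "s = (l, h)" by fastforce
    with s have l: "length l = n" "set l \<subseteq> I" and h: "h \<in> l2 X"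
      and nz: "word_op w (word_op (map Gen l) h) \<noteq> (\<lambda>n. 0)" by (simp_all add: P_def)
    have l': "set (w @ map Gen l) \<subseteq> gens I" using w l by auto
    have "word_op (w @ map Gen l) h = word_op (w @ map Gen l) (\<lambda>n. \<Sum>j\<in>I. T j (S j h) n)"
      using h by (simp only: sum_TS)
    also have "\<dots> = (\<lambda>n. \<Sum>j\<in>I. word_op (w @ map Gen l) (T j (S j h)) n)"
      using h by (intro word_op_sum[OF l']) simp
    finally have "\<exists>j\<in>I. word_op (w @ map Gen l) (T j (S j h)) \<noteq> (\<lambda>n. 0)"
      using nz by auto
    then obtain j where "j \<in> I" "word_op (w @ map Gen l) (T j (S j h)) \<noteq> (\<lambda>n. 0)" ..
    then show "\<exists>s'. P (Suc n) s' \<and> Q n s s'"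
      using l h by (intro exI[of _ "(l @ [j], S j h)"]) (simp add: P_def Q_def lh)
  qed
  then obtain s where P: "P n (s n)" and Q: "Q n (s n) (s (Suc n))" for n by blast
  define x where "x n = last (fst (s (Suc n)))" for n
  have app: "fst (s (Suc n)) = fst (s n) @ [x n]" for n
    using Q[of n] by (auto simp: x_def Q_def)
  have eq: "fst (s n) = map x [0..<n]" for n
  proof (induction n)
    case 0
    show ?case using P[of 0] by (simp add: P_def)
  qed (simp add: app)
  show ?thesis
  proof (intro exI conjI allI)
    show "x k \<in> I" for k using P[of "Suc k"] by (simp add: P_def eq)
    show "\<exists>g \<in> l2 X. word_op w (prefix_op x m g) \<noteq> (\<lambda>n. 0)" for m
      using P[of m] by (auto simp: P_def eq comp_def intro!: bexI[of _ "snd (s m)"])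
  qed
qed

lemma path_run_of_nonzero:
  assumes A: "\<And>i j. i \<in> I \<Longrightarrow> j \<in> I \<Longrightarrow> A i j \<le> 1"
    and w: "set w \<subseteq> letters I" and f: "f \<in> l2 X"
    and nz: "word_op (map letter_gen w) f \<noteq> (\<lambda>n. 0)"
  shows "\<exists>x \<in> paths I A. \<exists>y. path_run A w x y"
proof -
  have w': "set (map letter_gen w) \<subseteq> gens I" using w by fastforce
  obtain x where xI: "\<And>k. x k \<in> I"
    and x: "\<And>m. \<exists>g \<in> l2 X. word_op (map letter_gen w) (prefix_op x m g) \<noteq> (\<lambda>n. 0)"
    using nonzero_along_sequence[OF w' f nz] by blast
  have "A (x m) (x (Suc m)) \<noteq> 0" for m
  proof
    assume 0: "A (x m) (x (Suc m)) = 0"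
    obtain g where g: "g \<in> l2 X" and
      nz: "word_op (map letter_gen w) (prefix_op x (Suc (Suc m)) g) \<noteq> (\<lambda>n. 0)" using x by blast
    have "prefix_op x (Suc (Suc m)) g = prefix_op x m (T (x m) (T (x (Suc m)) g))" by simp
    also have "\<dots> = (\<lambda>n. 0)" using xI g 0 by (simp only: T_T_zero) (auto intro!: word_op_zero)
    finally show False using nz w' by simp
  qed
  then have "x \<in> paths I A" using xI by (simp add: paths_def)
  with word_op_prefix_op[OF A w this] x show ?thesis by blast
qed

end

section \<open>The representation on a tail-equivalence class of paths\<close>

text \<open>
  The operator of a partial injection \<open>g\<close> with domain \<open>D\<close>.  Its adjoint belongs to the inverse partial
  injection.
\<close>

definition shift_op :: "nat set \<Rightarrow> (nat \<Rightarrow> nat) \<Rightarrow> l2_op" where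
  "shift_op D g f = (\<lambda>n. if n \<in> D then f (g n) else 0)"

lemma suminf_eq_infsum:
  fixes u :: "nat \<Rightarrow> 'a :: banach"
  assumes "summable (\<lambda>n. norm (u n))" "\<And>n. n \<notin> D \<Longrightarrow> u n = 0"
  shows "suminf u = infsum u D"
proof -
  have "(u has_sum suminf u) UNIV"
    using assms(1) summable_norm_cancel[OF assms(1)]
    by (intro norm_summable_imp_has_sum summable_sums)
  then have "suminf u = infsum u UNIV" by (rule infsumI[symmetric])
  also have "\<dots> = infsum u D" using assms(2) by (intro infsum_cong_neutral) auto
  finally show ?thesis .
qed

lemma shift_op_square_sum:
  assumes inj: "inj_on g D" and f: "f \<in> l2 X"
  shows "summable (\<lambda>n. (cmod (shift_op D g f n))\<^sup>2)"
    and "suminf (\<lambda>n. (cmod (shift_op D g f n))\<^sup>2) \<le> suminf (\<lambda>n. (cmod (f n))\<^sup>2)"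
proof -
  let ?F = "\<lambda>n. (cmod (f n))\<^sup>2"
  have bound: "(\<Sum>n<N. (cmod (shift_op D g f n))\<^sup>2) \<le> suminf ?F" for N
  proof -
    have "(\<Sum>n<N. (cmod (shift_op D g f n))\<^sup>2) = (\<Sum>n\<in>{..<N} \<inter> D. ?F (g n))"
      by (intro sum.mono_neutral_cong_right) (auto simp: shift_op_def)
    also have "\<dots> = sum ?F (g ` ({..<N} \<inter> D))"
      using inj by (subst sum.reindex) (auto intro: inj_on_subset)
    also have "\<dots> \<le> suminf ?F"
      using l2_summable[OF f] by (intro sum_le_suminf) auto
    finally show ?thesis .
  qed
  from bound show "summable (\<lambda>n. (cmod (shift_op D g f n))\<^sup>2)"
    by (intro summableI_nonneg_bounded) auto
  then show "suminf (\<lambda>n. (cmod (shift_op D g f n))\<^sup>2) \<le> suminf ?F"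
    using bound by (intro suminf_le_const)
qed

lemma bounded_op_shift_op:
  assumes "inj_on g D" "D \<subseteq> X"
  shows "bounded_op X (shift_op D g)"
proof -
  have "shift_op D g f \<in> l2 X" if "f \<in> l2 X" for f
    using shift_op_square_sum(1)[OF assms(1) that] assms(2) by (auto simp: l2_def shift_op_def)
  moreover have "l2_norm (shift_op D g f) \<le> 1 * l2_norm f" if "f \<in> l2 X" for f
    using shift_op_square_sum(2)[OF assms(1) that] by (simp add: l2_norm_def)
  moreover have "shift_op D g (\<lambda>n. f n + h n) = (\<lambda>n. shift_op D g f n + shift_op D g h n)"
    "shift_op D g (\<lambda>n. c * f n) = (\<lambda>n. c * shift_op D g f n)" for f h c
    by (auto simp: shift_op_def)
  ultimately show ?thesis
    unfolding bounded_op_def by blast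
qed

lemma is_adjoint_shift_op:
  assumes D: "D \<subseteq> X" and E: "E \<subseteq> X" and g: "\<And>n. n \<in> D \<Longrightarrow> g n \<in> E \<and> h (g n) = n"
    and h: "\<And>n. n \<in> E \<Longrightarrow> h n \<in> D \<and> g (h n) = n"
  shows "is_adjoint X (shift_op D g) (shift_op E h)"
  unfolding is_adjoint_def
proof (intro ballI)
  fix f k assume f: "f \<in> l2 X" and k: "k \<in> l2 X"
  have injg: "inj_on g D" using g by (metis inj_onI)
  have injh: "inj_on h E" using h by (metis inj_onI)
  have f': "shift_op D g f \<in> l2 X" and k': "shift_op E h k \<in> l2 X"
    using bounded_op_shift_op[OF injg D] bounded_op_shift_op[OF injh E] f k
    by (auto simp: bounded_op_def)
  have "l2_inner (shift_op D g f) k = infsum (\<lambda>n. shift_op D g f n * cnj (k n)) D"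
    unfolding l2_inner_def using l2_summable_prod[OF f' k]
    by (intro suminf_eq_infsum) (auto simp: shift_op_def)
  also have "\<dots> = infsum (\<lambda>n. f n * cnj (shift_op E h k n)) E"
    using g h by (intro infsum_reindex_bij_witness[of D h g]) (auto simp: shift_op_def)
  also have "\<dots> = l2_inner f (shift_op E h k)"
    unfolding l2_inner_def using l2_summable_prod[OF f k']
    by (intro suminf_eq_infsum[symmetric]) (auto simp: shift_op_def)
  finally show "l2_inner (shift_op D g f) k = l2_inner f (shift_op E h k)" .
qed

text \<open>
  The set of all paths is uncountable in general.  The paths which agree with \<open>x\<close> after deletion of
  finite initial segments form a countable set that is invariant under all letters.
\<close>

definition tail_class :: "'i set \<Rightarrow> ('i \<Rightarrow> 'i \<Rightarrow> nat) \<Rightarrow> (nat \<Rightarrow> 'i) \<Rightarrow> (nat \<Rightarrow> 'i) set" where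
  "tail_class I A x = {y \<in> paths I A. \<exists>m n. \<forall>k. y (m + k) = x (n + k)}"

lemma tail_class_self: "x \<in> paths I A \<Longrightarrow> x \<in> tail_class I A x"
  by (auto simp: tail_class_def)

lemma tail_class_cons:
  assumes "y \<in> tail_class I A x" "i \<in> I" "A i (y 0) \<noteq> 0"
  shows "case_nat i y \<in> tail_class I A x"
proof -
  obtain m n where "\<forall>k. y (m + k) = x (n + k)" using assms by (auto simp: tail_class_def)
  then have "\<forall>k. case_nat i y (Suc m + k) = x (n + k)" by simp
  then show ?thesis using assms paths_cons[of y I A i] unfolding tail_class_def by blast
qed

lemma tail_class_tail:
  assumes "y \<in> tail_class I A x"
  shows "(\<lambda>n. y (Suc n)) \<in> tail_class I A x"
proof -
  obtain m n where mn: "\<forall>k. y (m + k) = x (n + k)" using assms by (auto simp: tail_class_def)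
  have "y (Suc (m + k)) = x (Suc n + k)" for k using mn[rule_format, of "Suc k"] by simp
  then show ?thesis using assms paths_tail[of y I A] unfolding tail_class_def by blast
qed

lemma countable_tail_class:
  assumes "finite I"
  shows "countable (tail_class I A x)"
proof (rule countable_subset)
  let ?F = "\<lambda>(l, n) k. if k < length l then l ! k else x (n + (k - length l))"
  show "countable (?F ` (lists I \<times> (UNIV :: nat set)))"
    using assms by (intro countable_image countable_SIGMA countable_lists) (auto simp: countable_finite)
  show "tail_class I A x \<subseteq> ?F ` (lists I \<times> UNIV)"
  proof
    fix y assume y: "y \<in> tail_class I A x"
    then obtain m n where mn: "\<forall>k. y (m + k) = x (n + k)" by (auto simp: tail_class_def)
    have "y k = ?F (map y [0..<m], n) k" for k
      using mn[rule_format, of "k - m"] by auto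
    moreover have "map y [0..<m] \<in> lists I"
      using y by (auto simp: tail_class_def paths_def)
    ultimately show "y \<in> ?F ` (lists I \<times> UNIV)"
      by (intro image_eqI[of _ _ "(map y [0..<m], n)"]) auto
  qed
qed

text \<open>
  Coding the countable tail-equivalence class of \<open>x0\<close> by natural numbers turns its \<open>l2\<close> space into
  one of the spaces \<open>l2 X\<close>.
\<close>

locale path_rep =
  fixes I :: "'i set" and A :: "'i \<Rightarrow> 'i \<Rightarrow> nat" and x0 :: "nat \<Rightarrow> 'i"
  assumes fin: "finite I" and A_le: "\<And>i j. i \<in> I \<Longrightarrow> j \<in> I \<Longrightarrow> A i j \<le> 1"
    and x0: "x0 \<in> paths I A"
begin

abbreviation "P \<equiv> tail_class I A x0"

definition "code = to_nat_on P"
definition "decode = from_nat_into P"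
definition "X = code ` P"

lemma decode_code [simp]: "y \<in> P \<Longrightarrow> decode (code y) = y"
  unfolding code_def decode_def using countable_tail_class[OF fin] by simp

lemma code_in_X [simp]: "y \<in> P \<Longrightarrow> code y \<in> X"
  by (simp add: X_def)

lemma X_cases: assumes "n \<in> X" obtains y where "y \<in> P" "n = code y"
  using assms by (auto simp: X_def)

lemma code_inj [simp]: "y \<in> P \<Longrightarrow> z \<in> P \<Longrightarrow> code y = code z \<longleftrightarrow> y = z"
  by (metis decode_code)

definition "starts i = {n \<in> X. decode n 0 = i}"
definition "extends i = {n \<in> X. A i (decode n 0) \<noteq> 0}"
definition "del n = code (\<lambda>k. decode n (Suc k))"
definition "ins i n = code (case_nat i (decode n))"

lemma del_starts:
  assumes "i \<in> I" "n \<in> starts i"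
  shows "del n \<in> extends i \<and> ins i (del n) = n"
proof -
  from assms obtain y where y: "y \<in> P" "n = code y" and i: "y 0 = i"
    by (auto simp: starts_def elim!: X_cases)
  have "A (y 0) (y (Suc 0)) \<noteq> 0" using y by (auto simp: tail_class_def paths_def)
  then show ?thesis
    using tail_class_tail[OF y(1)] y i case_nat_eta[of y] by (auto simp: del_def ins_def extends_def)
qed

lemma ins_extends:
  assumes "i \<in> I" "n \<in> extends i"
  shows "ins i n \<in> starts i \<and> del (ins i n) = n"
proof -
  from assms obtain y where y: "y \<in> P" "n = code y" and i: "A i (y 0) \<noteq> 0"
    by (auto simp: extends_def elim!: X_cases)
  then show ?thesis
    using tail_class_cons[OF y(1) assms(1) i] by (simp add: del_def ins_def starts_def)
qed

abbreviation "Tp i \<equiv> shift_op (starts i) del"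
abbreviation "Sp i \<equiv> shift_op (extends i) (ins i)"

lemma Tp_Sp: "i \<in> I \<Longrightarrow> Tp i (Sp i f) = (\<lambda>n. if n \<in> starts i then f n else 0)"
  using del_starts by (auto simp: shift_op_def)

lemma Sp_Tp: "i \<in> I \<Longrightarrow> Sp i (Tp i f) = (\<lambda>n. if n \<in> extends i then f n else 0)"
  using ins_extends by (auto simp: shift_op_def)

lemma decode_0: "n \<in> X \<Longrightarrow> decode n 0 \<in> I"
  by (erule X_cases) (simp add: tail_class_def paths_def)

lemma sum_starts:
  assumes "f \<in> l2 X"
  shows "(\<Sum>j\<in>I. c j * (if n \<in> starts j then f n else 0)) = c (decode n 0) * f n"
proof (cases "n \<in> X")
  case True
  then have "(\<Sum>j\<in>I. c j * (if n \<in> starts j then f n else 0)) =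
      (\<Sum>j\<in>I. if j = decode n 0 then c j * f n else 0)"
    by (intro sum.cong) (auto simp: starts_def)
  also have "\<dots> = c (decode n 0) * f n" using fin decode_0[OF True] by simp
  finally show ?thesis .
next
  case False
  then show ?thesis using assms by (simp add: starts_def l2_def)
qed

text \<open>
  The sum of the \<open>T j S j\<close> is 1 because every path has exactly one first symbol, and \<open>S i T i\<close> is
  the projection onto the paths that can follow \<open>i\<close>, which the relation describes by their first
  symbols.
\<close>

lemma ck_rep_paths: "ck_rep I A X Tp Sp"
proof -
  have sub: "starts i \<subseteq> X" "extends i \<subseteq> X" for i by (auto simp: starts_def extends_def)
  have adj: "is_adjoint X (Tp i) (Sp i)" if "i \<in> I" for i
    using del_starts[OF that] ins_extends[OF that] by (intro is_adjoint_shift_op sub)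
  have inj: "inj_on del (starts i)" "inj_on (ins i) (extends i)" if "i \<in> I" for i
    using del_starts[OF that] ins_extends[OF that] by (metis inj_onI)+
  have "Sp i (Tp i f) n = (\<Sum>j\<in>I. of_nat (A i j) * Tp j (Sp j f) n)"
    if i: "i \<in> I" and f: "f \<in> l2 X" for i f n
  proof -
    have "(\<Sum>j\<in>I. of_nat (A i j) * Tp j (Sp j f) n) =
        (\<Sum>j\<in>I. of_nat (A i j) * (if n \<in> starts j then f n else 0))"
      by (intro sum.cong) (simp_all add: Tp_Sp)
    also have "\<dots> = of_nat (A i (decode n 0)) * f n" by (rule sum_starts[OF f])
    also have "\<dots> = Sp i (Tp i f) n"
    proof (cases "n \<in> X")
      case True
      then show ?thesis
        using A_le[OF i decode_0[OF True]] unfolding Sp_Tp[OF i] by (auto simp: extends_def le_Suc_eq)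
    next
      case False
      then show ?thesis using f unfolding Sp_Tp[OF i] by (simp add: extends_def l2_def)
    qed
    finally show ?thesis by simp
  qed
  moreover have "(\<Sum>j\<in>I. Tp j (Sp j f) n) = f n" if f: "f \<in> l2 X" for f n
  proof -
    have "(\<Sum>j\<in>I. Tp j (Sp j f) n) = (\<Sum>j\<in>I. 1 * (if n \<in> starts j then f n else 0))"
      by (intro sum.cong) (simp_all add: Tp_Sp)
    also have "\<dots> = f n" using sum_starts[OF f, of "\<lambda>_. 1"] by simp
    finally show ?thesis .
  qed
  moreover have "Tp i (Sp i (Tp i f)) = Tp i f" if "i \<in> I" for i f
    unfolding Tp_Sp[OF that] by (auto simp: shift_op_def)
  ultimately show ?thesis
    using fin adj inj by (auto simp: ck_rep_def ck_family_def intro!: bounded_op_shift_op sub)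
qed

definition basis :: "(nat \<Rightarrow> 'i) \<Rightarrow> nat \<Rightarrow> complex" where
  "basis y = (\<lambda>n. if n = code y then 1 else 0)"

lemma basis_l2: "y \<in> P \<Longrightarrow> basis y \<in> l2 X"
  unfolding l2_def basis_def by (auto split: if_splits intro!: summable_finite[of "{code y}"])

lemma gen_op_basis:
  assumes c: "c \<in> letters I" and y: "y \<in> P" and step: "path_step A c y z"
  shows "z \<in> P \<and> gen_op Tp Sp (letter_gen c) (basis y) = basis z"
proof (cases c)
  case (Beta i)
  then have i: "i \<in> I" "A i (y 0) \<noteq> 0" and z: "z = case_nat i y" using c step by auto
  have zP: "z \<in> P" unfolding z by (rule tail_class_cons[OF y i])
  have iff: "n \<in> starts i \<and> del n = code y \<longleftrightarrow> n = code z" for n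
  proof
    assume n: "n \<in> starts i \<and> del n = code y"
    then have "n = ins i (code y)" using del_starts[OF i(1)] by metis
    then show "n = code z" using y by (simp add: ins_def z)
  next
    assume "n = code z"
    then have "n = ins i (code y)" using y by (simp add: ins_def z)
    moreover have "code y \<in> extends i" using y i by (simp add: extends_def)
    ultimately show "n \<in> starts i \<and> del n = code y" using ins_extends[OF i(1)] by simp
  qed
  have "Tp i (basis y) n = basis z n" for n
    using iff[of n] by (auto simp: shift_op_def basis_def)
  then show ?thesis using zP by (auto simp: Beta)
next
  case (Alpha i)
  then have i: "i \<in> I" "A i (z 0) \<noteq> 0" and z: "y = case_nat i z" using c step by auto
  have zP: "z \<in> P" using tail_class_tail[OF y] by (simp add: z)
  have iff: "n \<in> extends i \<and> ins i n = code y \<longleftrightarrow> n = code z" for n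
  proof
    assume n: "n \<in> extends i \<and> ins i n = code y"
    then have "n = del (code y)" using ins_extends[OF i(1)] by metis
    then show "n = code z" using y by (simp add: del_def z)
  next
    assume "n = code z"
    then have "n = del (code y)" using y by (simp add: del_def z)
    moreover have "code y \<in> starts i" using y by (simp add: starts_def) (simp add: z)
    ultimately show "n \<in> extends i \<and> ins i n = code y" using del_starts[OF i(1)] by simp
  qed
  have "Sp i (basis y) n = basis z n" for n
    using iff[of n] by (auto simp: shift_op_def basis_def)
  then show ?thesis using zP by (auto simp: Alpha)
qed

lemma word_op_basis:
  assumes "set w \<subseteq> letters I" "y \<in> P" "path_run A w y z"
  shows "z \<in> P \<and> foldr (gen_op Tp Sp) (map letter_gen w) (basis y) = basis z"
  using assms
proof (induction w arbitrary: z)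
  case (Cons c w)
  then obtain u where "path_run A w y u" and u: "path_step A c u z" by auto
  with Cons have "u \<in> P \<and> foldr (gen_op Tp Sp) (map letter_gen w) (basis y) = basis u" by simp
  moreover have "c \<in> letters I" using Cons.prems by simp
  ultimately show ?case using gen_op_basis[OF _ _ u] by simp
qed simp

end

theorem not_forbidden_iff_path_run:
  assumes fin: "finite I" and A: "\<And>i j. i \<in> I \<Longrightarrow> j \<in> I \<Longrightarrow> A i j \<le> 1"
    and w: "set w \<subseteq> letters I"
  shows "\<not> forbidden I A w \<longleftrightarrow> (\<exists>x \<in> paths I A. \<exists>y. path_run A w x y)"
proof
  assume "\<not> forbidden I A w"
  then obtain X T S f where "ck_rep I A X T S" "f \<in> l2 X"
    "foldr (gen_op T S) (map letter_gen w) f \<noteq> (\<lambda>n. 0)"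
    unfolding forbidden_iff_word_op_zero[OF fin w] by blast
  then show "\<exists>x \<in> paths I A. \<exists>y. path_run A w x y"
    using A w by (intro ck_rep.path_run_of_nonzero)
next
  assume "\<exists>x \<in> paths I A. \<exists>y. path_run A w x y"
  then obtain x y where x: "x \<in> paths I A" and run: "path_run A w x y" by blast
  interpret path_rep I A x using fin A x by unfold_locales
  have "basis y \<noteq> (\<lambda>n. 0)" by (auto simp: basis_def fun_eq_iff)
  then have "foldr (gen_op Tp Sp) (map letter_gen w) (basis x) \<noteq> (\<lambda>n. 0)"
    using word_op_basis[OF w tail_class_self[OF x] run] by simp
  then show "\<not> forbidden I A w"
    unfolding forbidden_iff_word_op_zero[OF fin w]
    using ck_rep_paths basis_l2[OF tail_class_self[OF x]] by blast
qed

section \<open>The language of a Markov-Dyck shift\<close>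

definition allowed_words :: "'i set \<Rightarrow> ('i \<Rightarrow> 'i \<Rightarrow> nat) \<Rightarrow> nat \<Rightarrow> 'i letter list set" where
  "allowed_words I A n =
    {w. length w = n \<and> set w \<subseteq> letters I \<and> (\<exists>x \<in> paths I A. \<exists>y. path_run A w x y)}"

lemma finite_allowed_words: "finite I \<Longrightarrow> finite (allowed_words I A n)"
  by (rule finite_subset[of _ "{w. set w \<subseteq> letters I \<and> length w = n}"])
    (auto simp: allowed_words_def intro: finite_lists_length_eq)

text \<open>
  The paths between the letters, numbered from left to right, so \<open>s 0\<close> is the final path.
\<close>

lemma path_run_states:
  assumes "set w \<subseteq> letters I" "x \<in> paths I A" "path_run A w x y"
  shows "\<exists>s. s 0 = y \<and> s (length w) = x \<and> (\<forall>k \<le> length w. s k \<in> paths I A) \<and>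
    (\<forall>k < length w. path_step A (w ! k) (s (Suc k)) (s k))"
  using assms
proof (induction w arbitrary: y)
  case Nil
  then show ?case by (auto intro!: exI[of _ "\<lambda>_. x"])
next
  case (Cons c w)
  then obtain z where run: "path_run A w x z" and step: "path_step A c z y" by auto
  have y: "y \<in> paths I A" using path_run_paths Cons.prems by blast
  obtain s where s: "s 0 = z" "s (length w) = x" "\<And>k. k \<le> length w \<Longrightarrow> s k \<in> paths I A"
    "\<And>k. k < length w \<Longrightarrow> path_step A (w ! k) (s (Suc k)) (s k)"
    using Cons.IH[OF _ _ run] Cons.prems by auto
  then show ?case
    using step y by (intro exI[of _ "case_nat y s"]) (auto simp: nth_Cons split: nat.split)
qed

lemma subword_Suc: "subword z k (Suc n) = z k # subword z (k + 1) n"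
  by (simp add: subword_def map_upt_Suc add_ac del: upt_Suc)

lemma length_subword [simp]: "length (subword z k n) = n"
  by (simp add: subword_def)

lemma path_run_subword:
  assumes "\<And>k. path_step A (z k) (s (k + 1)) (s k)"
  shows "path_run A (subword z k n) (s (k + int n)) (s k)"
proof (induction n arbitrary: k)
  case 0
  show ?case by (simp add: subword_def)
next
  case (Suc n)
  show ?case using Suc.IH[of "k + 1"] assms[of k] by (auto simp: subword_Suc add_ac)
qed

text \<open>
  To the right, \<open>Beta (x 0)\<close>, \<open>Beta (x 1)\<close>, \<open>\<dots>\<close> reconstruct the path \<open>x\<close> on which the word acts from
  its tails; to the left, predecessors are put in front of the resulting path.  The sequence \<open>s\<close> of
  all the intermediate paths shows that no finite piece of \<open>z\<close> is forbidden.
\<close>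

lemma allowed_word_extends:
  assumes pred: "\<And>j. j \<in> I \<Longrightarrow> \<exists>i \<in> I. A i j \<noteq> 0" and w: "w \<in> allowed_words I A n"
  shows "\<exists>z s. subword z 0 n = w \<and> (\<forall>k. z k \<in> letters I \<and> s k \<in> paths I A \<and>
    path_step A (z k) (s (k + 1)) (s k))"
proof -
  obtain x y where len: "length w = n" and letters: "set w \<subseteq> letters I"
    and x: "x \<in> paths I A" and run: "path_run A w x y"
    using w by (auto simp: allowed_words_def)
  obtain s where s: "s 0 = y" "s n = x" "\<And>k. k \<le> n \<Longrightarrow> s k \<in> paths I A"
    "\<And>k. k < n \<Longrightarrow> path_step A (w ! k) (s (Suc k)) (s k)"
    using path_run_states[OF letters x run] len by auto
  obtain pr where pr: "\<And>j. j \<in> I \<Longrightarrow> pr j \<in> I \<and> A (pr j) j \<noteq> 0"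
    using pred by metis
  define left where "left m = ((\<lambda>y. case_nat (pr (y 0)) y) ^^ m) y" for m
  have left: "left 0 = y" "left (Suc m) = case_nat (pr (left m 0)) (left m)" for m
    by (simp_all add: left_def)
  have left_path: "left m \<in> paths I A" for m
  proof (induction m)
    case 0
    show ?case using s(1) s(3)[of 0] by (simp add: left)
  next
    case (Suc m)
    then have "left m 0 \<in> I" by (simp add: paths_def)
    with pr Suc show ?case by (auto simp: left intro: paths_cons)
  qed
  then have left_I: "left m 0 \<in> I" for m by (simp add: paths_def)
  define right where "right m = (\<lambda>k. x (m + k))" for m
  have right: "right 0 = x" "right m = case_nat (x m) (right (Suc m))" for m
    by (auto simp: right_def fun_eq_iff split: nat.split)
  have right_path: "right m \<in> paths I A" for m using x by (auto simp: paths_def right_def)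
  define z where "z k = (if k < 0 then Beta (pr (left (nat (- k - 1)) 0))
    else if k < int n then w ! nat k else Beta (x (nat k - n)))" for k :: int
  define st where "st k = (if k < 0 then left (nat (- k))
    else if k < int n then s (nat k) else right (nat k - n))" for k :: int
  have step: "path_step A (z k) (st (k + 1)) (st k)" for k
  proof -
    consider "k < 0" | "0 \<le> k" "k < int n" | "int n \<le> k" by linarith
    then show ?thesis
    proof cases
      case 1
      have "st (k + 1) = left (nat (- k - 1))"
      proof (cases "k + 1 < int n")
        case True
        then show ?thesis using 1 s(1) by (auto simp: st_def left)
      next
        case False
        with 1 have "k + 1 = 0" "n = 0" by linarith+
        then show ?thesis using s(1,2) by (simp add: st_def left right(1))
      qed
      moreover have "st k = left (Suc (nat (- k - 1)))"
        using 1 by (simp add: st_def Suc_nat_eq_nat_zadd1)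
      ultimately show ?thesis
        using 1 pr[OF left_I, of "nat (- k - 1)"] by (simp add: z_def left)
    next
      case 2
      then have nk: "nat (k + 1) = Suc (nat k)" by linarith
      have "st (k + 1) = s (Suc (nat k))"
      proof (cases "k + 1 < int n")
        case True
        then show ?thesis using 2 by (simp add: st_def nk)
      next
        case False
        then have "Suc (nat k) = n" using 2 by linarith
        then show ?thesis using 2 False s(2) by (simp add: st_def nk right(1))
      qed
      then show ?thesis using 2 s(4)[of "nat k"] by (simp add: z_def st_def)
    next
      case 3
      then have "nat (k + 1) - n = Suc (nat k - n)" by linarith
      then have "st (k + 1) = right (Suc (nat k - n))" using 3 by (simp add: st_def)
      moreover have "A (x (nat k - n)) (right (Suc (nat k - n)) 0) \<noteq> 0"
        using x by (simp add: right_def paths_def)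
      ultimately show ?thesis using 3 right(2)[of "nat k - n"] by (simp add: z_def st_def)
    qed
  qed
  have letter: "z k \<in> letters I" for k
  proof -
    have "Beta (pr (left m 0)) \<in> letters I" "Beta (x m) \<in> letters I" for m
      using pr[OF left_I] x by (simp_all add: paths_def)
    moreover have "w ! nat k \<in> letters I" if "0 \<le> k" "k < int n"
    proof (rule subsetD[OF letters nth_mem])
      show "nat k < length w" using that len by linarith
    qed
    ultimately show ?thesis by (simp add: z_def)
  qed
  have path: "st k \<in> paths I A" for k
    using left_path right_path s(3) by (simp add: st_def)
  have word: "subword z 0 n = w"
    by (rule nth_equalityI) (simp_all add: len subword_def z_def)
  show ?thesis
    by (intro exI[of _ z] exI[of _ st] conjI allI word letter path step)
qed

theorem blocks_markov_dyck:
  assumes fin: "finite I" and A: "\<And>i j. i \<in> I \<Longrightarrow> j \<in> I \<Longrightarrow> A i j \<le> 1"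
    and pred: "\<And>j. j \<in> I \<Longrightarrow> \<exists>i \<in> I. A i j \<noteq> 0"
  shows "blocks n (markov_dyck I A) = allowed_words I A n"
proof (intro subset_antisym subsetI)
  fix w assume "w \<in> blocks n (markov_dyck I A)"
  then obtain z k where w: "w = subword z k n" and z: "\<And>k. z k \<in> letters I"
    and "\<not> forbidden I A (subword z k n)"
    by (auto simp: blocks_def markov_dyck_def)
  moreover have "set w \<subseteq> letters I" using z by (simp add: w subword_def image_subset_iff)
  ultimately show "w \<in> allowed_words I A n"
    using not_forbidden_iff_path_run[OF fin A] by (simp add: allowed_words_def)
next
  fix w assume w: "w \<in> allowed_words I A n"
  have "\<exists>z s. subword z 0 n = w \<and> (\<forall>k. z k \<in> letters I \<and> s k \<in> paths I A \<and>
      path_step A (z k) (s (k + 1)) (s k))"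
    by (rule allowed_word_extends[OF _ w]) (rule pred)
  then obtain z s where z: "subword z 0 n = w"
    and all: "\<forall>k. z k \<in> letters I \<and> s k \<in> paths I A \<and> path_step A (z k) (s (k + 1)) (s k)"
    by (elim exE conjE)
  then have letters: "z k \<in> letters I" and s: "s k \<in> paths I A"
    and step: "path_step A (z k) (s (k + 1)) (s k)" for k
    by simp_all
  have "\<not> forbidden I A (subword z k m)" for k m
  proof -
    have "set (subword z k m) \<subseteq> letters I" using letters by (simp add: subword_def image_subset_iff)
    then have "\<not> forbidden I A (subword z k m) \<longleftrightarrow>
        (\<exists>x \<in> paths I A. \<exists>y. path_run A (subword z k m) x y)"
      by (intro not_forbidden_iff_path_run fin A)
    moreover have "path_run A (subword z k m) (s (k + int m)) (s k)"
      by (rule path_run_subword) (rule step)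
    ultimately show ?thesis using s[of "k + int m"] by blast
  qed
  then have "z \<in> markov_dyck I A" unfolding markov_dyck_def using letters by (intro CollectI conjI allI)
  then show "w \<in> blocks n (markov_dyck I A)" using z by (auto simp: blocks_def)
qed

section \<open>Words over the edges and words over the vertices\<close>

text \<open>
  When a word acts on \<open>x\<close>, it removes \<open>depth w\<close> symbols of \<open>x\<close> altogether, and the result is
  \<open>height w\<close> new symbols followed by what is left of \<open>x\<close>.
\<close>

primrec height :: "'i letter list \<Rightarrow> nat" where
  "height [] = 0"
| "height (c # w) = (case c of Beta _ \<Rightarrow> Suc (height w) | Alpha _ \<Rightarrow> height w - 1)"

primrec depth :: "'i letter list \<Rightarrow> nat" where
  "depth [] = 0"
| "depth (c # w) = (case c of Beta _ \<Rightarrow> depth w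
    | Alpha _ \<Rightarrow> if height w = 0 then Suc (depth w) else depth w)"

lemma height_map: "height (map (map_letter f) w) = height w"
  by (induction w) (auto split: letter.split)

lemma depth_map: "depth (map (map_letter f) w) = depth w"
  by (induction w) (auto simp: height_map split: letter.split)

context nomulti_digraph
begin

abbreviation "edge_paths \<equiv> paths (arcs G) (edge_matrix G)"
abbreviation "vertex_paths \<equiv> paths (verts G) (vertex_matrix G)"

lemma edge_pathsD:
  "x \<in> edge_paths \<Longrightarrow> x n \<in> arcs G" "x \<in> edge_paths \<Longrightarrow> head G (x n) = tail G (x (Suc n))"
  by (auto simp: paths_def edge_matrix_def split: if_splits)

lemma edge_paths_iff: "x \<in> edge_paths \<longleftrightarrow> (\<forall>n. x n \<in> arcs G \<and> head G (x n) = tail G (x (Suc n)))"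
  by (auto simp: paths_def edge_matrix_def)

lemma arc_eqI:
  "e \<in> arcs G \<Longrightarrow> e' \<in> arcs G \<Longrightarrow> tail G e = tail G e' \<Longrightarrow> head G e = head G e' \<Longrightarrow> e = e'"
  using no_multi_arcs by (simp add: arc_to_ends_def)

lemma vertex_matrix_arc: "e \<in> arcs G \<Longrightarrow> vertex_matrix G (tail G e) (head G e) \<noteq> 0"
  by (auto simp: vertex_matrix_def)

lemma tail_path: "x \<in> edge_paths \<Longrightarrow> (\<lambda>n. tail G (x n)) \<in> vertex_paths"
proof -
  assume x: "x \<in> edge_paths"
  have "vertex_matrix G (tail G (x n)) (tail G (x (Suc n))) \<noteq> 0" for n
    using vertex_matrix_arc[of "x n"] edge_pathsD[OF x, of n] by simp
  then show ?thesis using edge_pathsD(1)[OF x] by (simp add: paths_def)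
qed

lemma path_step_tail:
  assumes "c \<in> letters (arcs G)" and step: "path_step (edge_matrix G) c x y"
  shows "path_step (vertex_matrix G) (map_letter (tail G) c) (\<lambda>n. tail G (x n)) (\<lambda>n. tail G (y n))"
proof -
  have *: "(\<lambda>n. tail G (case_nat e x n)) = case_nat (tail G e) (\<lambda>n. tail G (x n))" for e x
    by (auto simp: fun_eq_iff split: nat.split)
  have **: "vertex_matrix G (tail G e) (tail G (x 0)) \<noteq> 0"
    if "e \<in> arcs G" "edge_matrix G e (x 0) \<noteq> 0" for e and x :: "nat \<Rightarrow> 'b"
    using that vertex_matrix_arc[of e] by (auto simp: edge_matrix_def split: if_splits)
  show ?thesis using assms * ** by auto
qed

lemma path_run_tail:
  "set w \<subseteq> letters (arcs G) \<Longrightarrow> path_run (edge_matrix G) w x y \<Longrightarrow>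
    path_run (vertex_matrix G) (map (map_letter (tail G)) w) (\<lambda>n. tail G (x n)) (\<lambda>n. tail G (y n))"
proof (induction w arbitrary: y)
  case (Cons c w)
  then obtain z where "path_run (edge_matrix G) w x z" "path_step (edge_matrix G) c z y" by auto
  with Cons path_step_tail[of c z y] show ?case by auto
qed simp

text \<open>
  The edge path through the vertices of \<open>p\<close>.
\<close>

definition "lift p n = (SOME e. e \<in> arcs G \<and> tail G e = p n \<and> head G e = p (Suc n))"

lemma lift:
  assumes "p \<in> vertex_paths"
  shows "lift p n \<in> arcs G \<and> tail G (lift p n) = p n \<and> head G (lift p n) = p (Suc n)"
  unfolding lift_def
  by (rule someI_ex) (use assms in \<open>auto simp: paths_def vertex_matrix_def split: if_splits\<close>)

lemma lift_path: "p \<in> vertex_paths \<Longrightarrow> lift p \<in> edge_paths"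
  using lift[of p] by (simp add: edge_paths_iff)

lemma lift_cons:
  assumes "case_nat v p \<in> vertex_paths" "p \<in> vertex_paths"
  shows "lift (case_nat v p) = case_nat (lift (case_nat v p) 0) (lift p)"
    "edge_matrix G (lift (case_nat v p) 0) (lift p 0) \<noteq> 0"
  using lift[OF assms(1), of 0] lift[OF assms(2), of 0]
  by (auto simp: fun_eq_iff edge_matrix_def lift_def split: nat.split)

text \<open>
  Both letters concern the first edge of the longer one of the two paths, and the lifts of these paths
  share all other edges.
\<close>

lemma path_step_lift:
  assumes "p \<in> vertex_paths" "q \<in> vertex_paths" and step: "path_step (vertex_matrix G) c p q"
  shows "\<exists>c' \<in> letters (arcs G). map_letter (tail G) c' = c \<and>
    path_step (edge_matrix G) c' (lift p) (lift q)"
proof (cases c)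
  case (Beta v)
  then have q: "q = case_nat v p" using step by simp
  show ?thesis
    using lift[OF assms(2), of 0] lift_cons[of v p] assms
    by (intro bexI[of _ "Beta (lift q 0)"]) (auto simp: Beta q)
next
  case (Alpha v)
  then have p: "p = case_nat v q" using step by simp
  show ?thesis
    using lift[OF assms(1), of 0] lift_cons[of v q] assms
    by (intro bexI[of _ "Alpha (lift p 0)"]) (auto simp: Alpha p)
qed

lemma path_run_lift:
  assumes "set w \<subseteq> letters (verts G)" "p \<in> vertex_paths" "path_run (vertex_matrix G) w p q"
  shows "\<exists>w'. map (map_letter (tail G)) w' = w \<and> set w' \<subseteq> letters (arcs G) \<and>
    path_run (edge_matrix G) w' (lift p) (lift q)"
  using assms
proof (induction w arbitrary: q)
  case (Cons c w)
  then obtain r where run: "path_run (vertex_matrix G) w p r"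
    and step: "path_step (vertex_matrix G) c r q" by auto
  have cw: "c \<in> letters (verts G)" "set w \<subseteq> letters (verts G)" using Cons.prems(1) by auto
  have r: "r \<in> vertex_paths" by (rule path_run_paths[OF cw(2) Cons.prems(2) run])
  have q: "q \<in> vertex_paths" by (rule path_step_paths[OF cw(1) r step])
  obtain w' where w': "map (map_letter (tail G)) w' = w" "set w' \<subseteq> letters (arcs G)"
    "path_run (edge_matrix G) w' (lift p) (lift r)" using Cons.IH[OF cw(2) Cons.prems(2) run] by blast
  obtain c' where "c' \<in> letters (arcs G)" "map_letter (tail G) c' = c"
    "path_step (edge_matrix G) c' (lift r) (lift q)" using path_step_lift[OF r q step] by blast
  with w' show ?case by (intro exI[of _ "c' # w'"]) auto
qed simp

lemma allowed_vertex_words_eq: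
  "allowed_words (verts G) (vertex_matrix G) n =
    map (map_letter (tail G)) ` allowed_words (arcs G) (edge_matrix G) n"
proof (intro subset_antisym subsetI)
  fix w assume "w \<in> allowed_words (verts G) (vertex_matrix G) n"
  then obtain p q where w: "length w = n" "set w \<subseteq> letters (verts G)" and p: "p \<in> vertex_paths"
    and run: "path_run (vertex_matrix G) w p q" by (auto simp: allowed_words_def)
  from path_run_lift[OF w(2) p run] obtain w' where w': "map (map_letter (tail G)) w' = w"
    "set w' \<subseteq> letters (arcs G)" "path_run (edge_matrix G) w' (lift p) (lift q)" by blast
  moreover have "length w' = n" using w(1) w'(1) by auto
  ultimately have "w' \<in> allowed_words (arcs G) (edge_matrix G) n"
    using lift_path[OF p] by (auto simp: allowed_words_def)
  with w'(1) show "w \<in> map (map_letter (tail G)) ` allowed_words (arcs G) (edge_matrix G) n" by blast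
next
  fix w assume "w \<in> map (map_letter (tail G)) ` allowed_words (arcs G) (edge_matrix G) n"
  then obtain w' x y where w': "w = map (map_letter (tail G)) w'" "length w' = n"
    "set w' \<subseteq> letters (arcs G)" and x: "x \<in> edge_paths" and run: "path_run (edge_matrix G) w' x y"
    by (auto simp: allowed_words_def)
  have "set w \<subseteq> letters (verts G)" using w' by fastforce
  then show "w \<in> allowed_words (verts G) (vertex_matrix G) n"
    using path_run_tail[OF w'(3) run] tail_path[OF x] w' by (auto simp: allowed_words_def)
qed

text \<open>
  Two edge words over the same vertex word have removed edges with the same tails and have put edges with
  the same tails in front.  The head of an edge that is put in front or removed is the next vertex of the
  path; this can only differ if it is the vertex at position \<open>depth w\<close> of the starting paths.  The claims
  about removed edges, new edges and the common rest are what the induction needs to locate that vertex.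
\<close>

lemma vertex_word_determines:
  assumes "set w \<subseteq> letters (arcs G)" "set w' \<subseteq> letters (arcs G)"
    and "x \<in> edge_paths" "x' \<in> edge_paths"
    and "path_run (edge_matrix G) w x y" "path_run (edge_matrix G) w' x' y'"
    and "map (map_letter (tail G)) w = map (map_letter (tail G)) w'"
  shows "(\<forall>i < depth w. tail G (x i) = tail G (x' i)) \<and>
    (\<forall>i < height w. tail G (y i) = tail G (y' i)) \<and>
    (\<forall>n. y (height w + n) = x (depth w + n)) \<and> (\<forall>n. y' (height w + n) = x' (depth w + n)) \<and>
    (tail G (x (depth w)) = tail G (x' (depth w)) \<longrightarrow> w = w')"
  using assms
proof (induction w arbitrary: w' y y')
  case Nil
  then show ?case by simp
next
  case (Cons c w v)
  then obtain c' w' where v: "v = c' # w'" by (cases v) auto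
  from Cons.prems obtain z where run: "path_run (edge_matrix G) w x z"
    and step: "path_step (edge_matrix G) c z y" by auto
  from Cons.prems obtain z' where run': "path_run (edge_matrix G) w' x' z'"
    and step': "path_step (edge_matrix G) c' z' y'" by (auto simp: v)
  have cc: "c \<in> letters (arcs G)" "c' \<in> letters (arcs G)" "map_letter (tail G) c = map_letter (tail G) c'"
    using Cons.prems by (auto simp: v)
  have z: "z \<in> edge_paths" "z' \<in> edge_paths"
    using path_run_paths[OF _ _ run] path_run_paths[OF _ _ run'] Cons.prems by (auto simp: v)
  let ?c = "height w" and ?d = "depth w"
  have IH: "\<And>i. i < ?d \<Longrightarrow> tail G (x i) = tail G (x' i)"
    "\<And>i. i < ?c \<Longrightarrow> tail G (z i) = tail G (z' i)"
    "\<And>n. z (?c + n) = x (?d + n)" "\<And>n. z' (?c + n) = x' (?d + n)"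
    "tail G (x ?d) = tail G (x' ?d) \<Longrightarrow> w = w'"
    using Cons.IH[OF _ _ _ _ run run'] Cons.prems by (auto simp: v)
  \<comment> \<open>The tails of \<open>z\<close> and \<open>z'\<close> agree below position \<open>?c\<close>, and at \<open>?c\<close> they are those of \<open>x ?d\<close>, \<open>x' ?d\<close>.\<close>
  have agree: "tail G (z i) = tail G (z' i)"
    if "tail G (x ?d) = tail G (x' ?d)" "i \<le> ?c" for i
    using that IH(2)[of i] IH(3)[of 0] IH(4)[of 0] by (cases "i = ?c") auto
  show ?case
  proof (cases c)
    case (Beta e)
    then obtain e' where c': "c' = Beta e'" using cc by (cases c') auto
    have e: "e \<in> arcs G" "e' \<in> arcs G" "tail G e = tail G e'" using cc Beta c' by auto
    have y: "y = case_nat e z" "head G e = tail G (z 0)" "y' = case_nat e' z'" "head G e' = tail G (z' 0)"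
      using step step' by (auto simp: Beta c' edge_matrix_def split: if_splits)
    have "tail G (y i) = tail G (y' i)" if "i < Suc ?c" for i
      using that IH(2)[of "i - 1"] e y by (cases i) auto
    moreover have "c # w = v" if "tail G (x ?d) = tail G (x' ?d)"
      using arc_eqI[OF e(1-3)] agree[OF that, of 0] IH(5)[OF that] y by (simp add: v Beta c')
    ultimately show ?thesis using IH(1,3,4) by (simp add: Beta y)
  next
    case (Alpha e)
    then obtain e' where c': "c' = Alpha e'" using cc by (cases c') auto
    have e: "e \<in> arcs G" "e' \<in> arcs G" "tail G e = tail G e'" using cc Alpha c' by auto
    have y: "z = case_nat e y" "z' = case_nat e' y'"
      using step step' by (auto simp: Alpha c')
    have head: "head G e = tail G (y 0)" "head G e' = tail G (y' 0)"
      using edge_pathsD(2)[OF z(1), of 0] edge_pathsD(2)[OF z(2), of 0] y by auto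
    show ?thesis
    proof (cases ?c)
      case 0
      \<comment> \<open>The letter removes an edge of the starting path, so the free vertex moves one step along it, and
        the former one is now recorded as the tail of the removed edge.\<close>
      have x: "x ?d = e" "x' ?d = e'" "\<And>n. y n = x (Suc (?d + n))" "\<And>n. y' n = x' (Suc (?d + n))"
        using IH(3)[of 0] IH(4)[of 0] IH(3)[of "Suc _"] IH(4)[of "Suc _"] 0 y by auto
      have "tail G (x i) = tail G (x' i)" if "i < Suc ?d" for i
        using that IH(1) x(1,2) e(3) by (cases "i = ?d") auto
      moreover have "c # w = v" if "tail G (x (Suc ?d)) = tail G (x' (Suc ?d))"
        using that IH(5) x(1,2) x(3,4)[of 0] e head arc_eqI[OF e(1-3)] by (simp add: v Alpha c')
      ultimately show ?thesis using x(3,4) by (simp add: Alpha 0)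
    next
      case (Suc k)
      have "tail G (y i) = tail G (y' i)" if "i < k" for i
        using that IH(2)[of "Suc i"] y Suc by simp
      moreover have "y (k + n) = x (?d + n)" "y' (k + n) = x' (?d + n)" for n
        using IH(3,4)[of n] Suc y by auto
      moreover have "c # w = v" if eq: "tail G (x ?d) = tail G (x' ?d)"
        using agree[OF eq, of "Suc 0"] Suc y head arc_eqI[OF e(1-3)] IH(5)[OF eq]
        by (simp add: v Alpha c')
      ultimately show ?thesis using IH(1) by (simp add: Alpha Suc)
    qed
  qed
qed

text \<open>
  A word over the edges is recovered from its vertex word and the vertex at position \<open>depth w\<close> of a path
  on which it acts.
\<close>

lemma card_allowed_edge_words_le:
  assumes "finite (verts G)" "finite (arcs G)"
  shows "card (allowed_words (arcs G) (edge_matrix G) n)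
    \<le> card (allowed_words (verts G) (vertex_matrix G) n) * card (verts G)"
proof -
  let ?E = "allowed_words (arcs G) (edge_matrix G) n"
  let ?V = "allowed_words (verts G) (vertex_matrix G) n"
  have "\<forall>w \<in> ?E. \<exists>x. x \<in> edge_paths \<and> (\<exists>y. path_run (edge_matrix G) w x y)"
    by (auto simp: allowed_words_def)
  then obtain src where src: "\<And>w. w \<in> ?E \<Longrightarrow> src w \<in> edge_paths"
    and run: "\<And>w. w \<in> ?E \<Longrightarrow> \<exists>y. path_run (edge_matrix G) w (src w) y" by metis
  let ?f = "\<lambda>w. (map (map_letter (tail G)) w, tail G (src w (depth w)))"
  have "inj_on ?f ?E"
  proof (rule inj_onI)
    fix w w' assume w: "w \<in> ?E" and w': "w' \<in> ?E" and eq: "?f w = ?f w'"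
    then have map_eq: "map (map_letter (tail G)) w = map (map_letter (tail G)) w'"
      and tail_eq: "tail G (src w (depth w)) = tail G (src w' (depth w'))" by simp_all
    have depth_eq: "depth w = depth w'"
      using depth_map[of "tail G" w] depth_map[of "tail G" w'] map_eq by simp
    obtain y where y: "path_run (edge_matrix G) w (src w) y" using run[OF w] ..
    obtain y' where y': "path_run (edge_matrix G) w' (src w') y'" using run[OF w'] ..
    have "set w \<subseteq> letters (arcs G)" "set w' \<subseteq> letters (arcs G)"
      using w w' by (simp_all add: allowed_words_def)
    from vertex_word_determines[OF this src[OF w] src[OF w'] y y' map_eq]
    show "w = w'" using tail_eq unfolding depth_eq by (elim conjE) simp
  qed
  moreover have "?f ` ?E \<subseteq> ?V \<times> verts G"
  proof (rule image_subsetI)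
    fix w assume w: "w \<in> ?E"
    then have "map (map_letter (tail G)) w \<in> ?V" unfolding allowed_vertex_words_eq by (rule imageI)
    moreover have "tail G (src w (depth w)) \<in> verts G"
      by (rule tail_in_verts[OF edge_pathsD(1)[OF src[OF w]]])
    ultimately show "?f w \<in> ?V \<times> verts G" by simp
  qed
  moreover have "finite (?V \<times> verts G)"
    using assms by (intro finite_cartesian_product finite_allowed_words)
  ultimately have "card ?E \<le> card (?V \<times> verts G)" by (rule card_inj_on_le)
  then show ?thesis by (simp add: card_cartesian_product)
qed

end

section \<open>Entropy\<close>

text \<open>
  The sequences that define the two entropies differ by a null sequence, so they have the same limits, and
  \<open>lim\<close> gives the same value whether or not there is one.
\<close>

lemma h_top_eqI:
  assumes "\<And>n. card (blocks n \<Lambda>) \<le> card (blocks n \<Lambda>')"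
    and "\<And>n. card (blocks n \<Lambda>') \<le> card (blocks n \<Lambda>) * K"
  shows "h_top \<Lambda> = h_top \<Lambda>'"
proof -
  define u where "u n = ln (real (card (blocks n \<Lambda>)))" for n
  define v where "v n = ln (real (card (blocks n \<Lambda>')))" for n
  have uv: "u n \<le> v n \<and> v n \<le> u n + ln (real (max K 1))" for n
  proof (cases "card (blocks n \<Lambda>) = 0")
    case True
    then have "card (blocks n \<Lambda>') = 0" using assms(2)[of n] by simp
    with True show ?thesis by (simp add: u_def v_def)
  next
    case False
    have "card (blocks n \<Lambda>') \<le> card (blocks n \<Lambda>) * max K 1"
      using assms(2)[of n] by (rule order_trans) simp
    then have "real (card (blocks n \<Lambda>')) \<le> real (card (blocks n \<Lambda>)) * real (max K 1)"
      by (simp only: of_nat_le_iff flip: of_nat_mult)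
    moreover have "0 < real (card (blocks n \<Lambda>'))" using False assms(1)[of n] by simp
    ultimately have "v n \<le> ln (real (card (blocks n \<Lambda>)) * real (max K 1))"
      unfolding v_def by (intro ln_mono) auto
    also have "\<dots> = u n + ln (real (max K 1))"
      unfolding u_def using False by (intro ln_mult_pos) auto
    finally show ?thesis
      using False assms(1)[of n] by (simp add: u_def v_def)
  qed
  have diff: "(\<lambda>n. v n / real n - u n / real n) \<longlonglongrightarrow> 0"
  proof (rule tendsto_sandwich[OF _ _ tendsto_const])
    show "(\<lambda>n. ln (real (max K 1)) / real n) \<longlonglongrightarrow> 0" by (rule lim_const_over_n)
    show "\<forall>\<^sub>F n in sequentially. 0 \<le> v n / real n - u n / real n"
      using uv by (intro always_eventually allI) (simp add: divide_right_mono)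
    have "(v n - u n) / real n \<le> ln (real (max K 1)) / real n" for n
      using uv[of n] by (intro divide_right_mono) auto
    then show "\<forall>\<^sub>F n in sequentially. v n / real n - u n / real n \<le> ln (real (max K 1)) / real n"
      unfolding diff_divide_distrib by (intro always_eventually allI)
  qed
  have "(\<lambda>n. u n / real n) \<longlonglongrightarrow> l \<longleftrightarrow> (\<lambda>n. v n / real n) \<longlonglongrightarrow> l" for l
  proof
    show "(\<lambda>n. v n / real n) \<longlonglongrightarrow> l" if "(\<lambda>n. u n / real n) \<longlonglongrightarrow> l"
      using tendsto_add[OF that diff] by simp
    show "(\<lambda>n. u n / real n) \<longlonglongrightarrow> l" if "(\<lambda>n. v n / real n) \<longlonglongrightarrow> l"
      using tendsto_diff[OF that diff] by simp
  qed
  then show ?thesis by (simp add: h_top_def lim_def u_def v_def)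
qed

theorem theorem2p10:
  fixes G :: "('v, 'e) pre_digraph"
  assumes "fin_digraph G"
    and "nomulti_digraph G"
    and "\<And>v. v \<in> verts G \<Longrightarrow> in_arcs G v \<noteq> {}"
    and "\<And>v. v \<in> verts G \<Longrightarrow> out_arcs G v \<noteq> {}"
  shows "h_top (markov_dyck_vertex G) = h_top (markov_dyck_edge G)"
proof -
  interpret fin_digraph G by fact
  interpret nomulti_digraph G by fact
  have pred: "\<exists>e \<in> arcs G. head G e = v" if "v \<in> verts G" for v
    using assms(3)[OF that] by auto
  have V: "blocks n (markov_dyck_vertex G) = allowed_words (verts G) (vertex_matrix G) n" for n
    unfolding markov_dyck_vertex_def
  proof (rule blocks_markov_dyck)
    fix v assume "v \<in> verts G"
    then obtain e where e: "e \<in> arcs G" "head G e = v" using pred by blast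
    then have "vertex_matrix G (tail G e) v \<noteq> 0" using vertex_matrix_arc[of e] by simp
    then show "\<exists>u\<in>verts G. vertex_matrix G u v \<noteq> 0" using e(1) tail_in_verts by blast
  qed (simp_all add: vertex_matrix_def)
  have E: "blocks n (markov_dyck_edge G) = allowed_words (arcs G) (edge_matrix G) n" for n
    unfolding markov_dyck_edge_def
  proof (rule blocks_markov_dyck)
    fix f assume "f \<in> arcs G"
    then obtain e where "e \<in> arcs G" "head G e = tail G f" using pred tail_in_verts by blast
    then show "\<exists>e\<in>arcs G. edge_matrix G e f \<noteq> 0"
      by (intro bexI[of _ e]) (simp_all add: edge_matrix_def)
  qed (simp_all add: edge_matrix_def)
  show ?thesis
  proof (rule h_top_eqI)
    show "card (blocks n (markov_dyck_vertex G)) \<le> card (blocks n (markov_dyck_edge G))" for n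
      unfolding V E allowed_vertex_words_eq by (intro card_image_le finite_allowed_words finite_arcs)
    show "card (blocks n (markov_dyck_edge G)) \<le> card (blocks n (markov_dyck_vertex G)) * card (verts G)"
      for n
      unfolding V E by (intro card_allowed_edge_words_le finite_verts finite_arcs)
  qed
qed

end
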